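(* For every integer $k\ge1$ and every $\delta>0$ there exists a $\gamma>0$ such that for every sequence of densities $p=p(n)$ with $0<p\le 1$ there exists an $n_0$ such that for every $n\ge n_0$ the following holds. If $\Gamma$ is an $n$-vertex $(p,\beta)$-jumbled graph with $$\beta=\beta(n)\le\gamma\,p^{1+\frac{1}{2k-1}}\,n\,\log^{-2(k-1)}n,$$ then $$\mathrm{ex}(\Gamma,C_{2k+1})<\left(\frac12+\delta\right)p\binom n2 .$$
   Context: All graphs are finite and simple. For graphs $G$ and $F$, $\mathrm{ex}(G,F)$ is the maximum number of edges in a subgraph of $G$ that contains no copy of $F$ as a (not necessarily induced) subgraph. $C_{2k+1}$ is the cycle of length $2k+1$, and $\log^{-2(k-1)}n=(\log n)^{-2(k-1)}$. For a graph $\Gamma$ and $X,Y\subseteq V(\Gamma)$, $\mathrm{vol}(X,Y)$ is the number of all (unordered) pairs of distinct vertices with one element from $X$ and the other from $Y$ (so $\mathrm{vol}(X,Y)=|X||Y|$ for disjoint $X,Y$ and $\mathrm{vol}(X,X)=\binom{|X|}{2}$), and $e_\Gamma(X,Y)$ is the number of edges $xy\in E(\Gamma)$ with $x\in X$ and $y\in Y$. For $p=p(n)$ and $\beta=\beta(n)$, an $n$-vertex graph $\Gamma$ is $(p,\beta)$-jumbled if $$\left|e_\Gamma(X,Y)-p\,\mathrm{vol}(X,Y)\right|\le\beta\,\mathrm{vol}(X,Y)^{1/2}\quad\text{for all }X,Y\subseteq V(\Gamma).$$ *)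

theory Defs
  imports Complex_Main "HOL-Library.Ramsey"
begin

type_synonym 'a graph = "'a set \<times> 'a set set"

abbreviation verts :: "'a graph \<Rightarrow> 'a set" where
  "verts G \<equiv> fst G"

abbreviation edges :: "'a graph \<Rightarrow> 'a set set" where
  "edges G \<equiv> snd G"

definition finite_simple_graph :: "'a graph \<Rightarrow> bool" where
  "finite_simple_graph G \<longleftrightarrow> finite (verts G) \<and> edges G \<subseteq> nsets (verts G) 2"

definition subgraph :: "'a graph \<Rightarrow> 'a graph \<Rightarrow> bool" where
  "subgraph H G \<longleftrightarrow> finite_simple_graph H \<and> verts H \<subseteq> verts G \<and> edges H \<subseteq> edges G"

text \<open>A copy need not be induced: only edges have to be preserved.\<close>

definition contains_copy :: "'a graph \<Rightarrow> 'b graph \<Rightarrow> bool" where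
  "contains_copy G F \<longleftrightarrow>
     (\<exists>f. inj_on f (verts F) \<and> f ` verts F \<subseteq> verts G \<and> (\<forall>e\<in>edges F. f ` e \<in> edges G))"

text \<open>The set below is finite for a finite simple graph G, and nonempty as soon as F has an edge,
  so the maximum is attained in all cases of interest.\<close>

definition ex :: "'a graph \<Rightarrow> 'b graph \<Rightarrow> nat" where
  "ex G F = Max {card (edges H) | H. subgraph H G \<and> \<not> contains_copy H F}"

text \<open>This is the cycle of length m only for m at least 3.\<close>

definition cycle_graph :: "nat \<Rightarrow> nat graph" where
  "cycle_graph m = ({..<m}, (\<lambda>i. {i, Suc i mod m}) ` {..<m})"

definition pairs_between :: "'a set \<Rightarrow> 'a set \<Rightarrow> 'a set set" where
  "pairs_between X Y = {{x, y} | x y. x \<in> X \<and> y \<in> Y \<and> x \<noteq> y}"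

definition vol :: "'a set \<Rightarrow> 'a set \<Rightarrow> nat" where
  "vol X Y = card (pairs_between X Y)"

definition edges_between :: "'a graph \<Rightarrow> 'a set \<Rightarrow> 'a set \<Rightarrow> nat" where
  "edges_between G X Y = card (edges G \<inter> pairs_between X Y)"

definition jumbled :: "real \<Rightarrow> real \<Rightarrow> 'a graph \<Rightarrow> bool" where
  "jumbled p \<beta> G \<longleftrightarrow>
     (\<forall>X Y. X \<subseteq> verts G \<longrightarrow> Y \<subseteq> verts G \<longrightarrow>
        \<bar>real (edges_between G X Y) - p * real (vol X Y)\<bar> \<le> \<beta> * sqrt (real (vol X Y)))"

lemma vol_self:
  assumes "finite X"
  shows "vol X X = card X choose 2"
proof -
  have "pairs_between X X = nsets X 2"
    by (auto simp: pairs_between_def nsets_2_eq)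
  then show ?thesis
    by (simp add: vol_def)
qed

lemma vol_disjoint:
  assumes "X \<inter> Y = {}"
  shows "vol X Y = card X * card Y"
proof -
  have "pairs_between X Y = (\<lambda>(x, y). {x, y}) ` (X \<times> Y)"
    using assms by (auto simp: pairs_between_def image_iff) blast+
  moreover have "inj_on (\<lambda>(x, y). {x, y}) (X \<times> Y)"
    using assms by (auto simp: inj_on_def doubleton_eq_iff)
  ultimately show ?thesis
    by (simp add: vol_def card_image card_cartesian_product)
qed

lemma finite_simple_graph_cycle:
  assumes "m \<ge> 3"
  shows "finite_simple_graph (cycle_graph m)"
proof -
  have "i \<noteq> Suc i mod m" if "i < m" for i
    using that assms by (cases "Suc i = m") auto
  with assms show ?thesis
    by (auto simp: finite_simple_graph_def cycle_graph_def nsets_def card_2_iff)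
qed

lemma ex_attained:
  assumes "finite_simple_graph G" "edges F \<noteq> {}"
  shows "\<exists>H. subgraph H G \<and> \<not> contains_copy H F \<and> card (edges H) = ex G F"
    and "\<And>H. \<lbrakk>subgraph H G; \<not> contains_copy H F\<rbrakk> \<Longrightarrow> card (edges H) \<le> ex G F"
proof -
  let ?S = "{card (edges H) | H. subgraph H G \<and> \<not> contains_copy H F}"
  have fin: "finite (edges G)"
    using assms(1) unfolding finite_simple_graph_def
    by (meson finite_imp_finite_nsets finite_subset)
  have "?S \<subseteq> {..card (edges G)}"
    using fin by (auto simp: subgraph_def intro: card_mono)
  then have S: "finite ?S"
    using finite_subset by blast
  have "subgraph ({}, {}) G \<and> \<not> contains_copy ({}, {}) F"
    using assms(2) by (auto simp: subgraph_def contains_copy_def finite_simple_graph_def)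
  then have "?S \<noteq> {}" by blast
  with S have "ex G F \<in> ?S"
    unfolding ex_def by (rule Max_in)
  then show "\<exists>H. subgraph H G \<and> \<not> contains_copy H F \<and> card (edges H) = ex G F"
    unfolding mem_Collect_eq by metis
  show "card (edges H) \<le> ex G F" if "subgraph H G" "\<not> contains_copy H F" for H
    unfolding ex_def using S that by (intro Max_ge) blast+
qed

end

theory Submission
  imports Defs "HOL-Analysis.L2_Norm"
begin

text \<open>
  Let A be the adjacency matrix of a dense subgraph of a pseudorandom graph, B the adjacency
  matrix of that graph, J the all-one matrix, and B = p J + E. The whole proof rests on the
  inequality

    0 \<le> tr (A^k (B - A) A^(k-1) (B - A)),

  whose right-hand side counts closed walks of length 2k+1 in which two almost antipodal steps
  avoid the subgraph and all other steps stay in it. Expanding the product and rotating the traces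
  turns it into

    2 tr (A^(2k) B) \<le> tr (A^k B A^(k-1) B) + tr (A^(2k+1))

  (\<open>two_antipodal_edges\<close>). Let W_i be the number of walks of length i in the subgraph and m the
  number of vertices. If B is replaced by p J, the two traces with B become p W_(2k), which is at
  least p W_k^2 / m by Cauchy-Schwarz, and p^2 W_k W_(k-1). A minimum degree of at least
  (1/2 + \<delta>) p m gives W_k \<ge> (1/2 + \<delta>) p m W_(k-1), so the left-hand side exceeds the first trace
  on the right by a factor of at least 1 + 2 \<delta>. Hence tr (A^(2k+1)) is large: the subgraph has
  many closed walks of length 2k+1, and such a walk without repeated vertices is the required cycle.

  Three points make this rigorous.

  First, replacing B by p J costs at most a constant times b tr (B^(2k)) + b p m \<Delta>^(2k-1), where b
  bounds the bilinear form of E and \<Delta> is the maximum degree. In tr (B^(2k)), the sum over v of the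
  square norms of B^(k-1) 1_N(v), the first step of a walk spreads over the whole neighbourhood
  N(v), and only the other k-1 steps are estimated through b (\<open>sum_sq_mpow_col_le\<close>). The resulting
  error term m b^(2k-1) \<Delta> has to be small against (p m)^(2k+1), and this is what the exponent
  1 + 1/(2k-1) of p in the theorem says.

  Second, jumbledness speaks about sets, whereas the bilinear form is evaluated at walk counts.
  These are natural numbers with at most 1 + (k-1) log_2 n binary digits, and splitting them into
  digits loses only a factor equal to the number of digits (\<open>bilinear_bound_of_cut_bound\<close>). For k = 1
  there is one digit and no loss, so triangles need no logarithm.

  Third, a closed walk with a repeated vertex splits there into two shorter closed walks. The
  spreading estimate bounds the number of those at every vertex, so such walks are negligible
  (\<open>closed_walks_le_sum_degenerate\<close>, \<open>closed_odd_walks_upper\<close>).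

  Finally, a subgraph with more than (1/2 + \<delta>) p (n choose 2) edges has linearly many vertices on
  which the degree conditions hold (\<open>dense_core\<close>), and jumbledness is inherited by subsets.
\<close>

section \<open>Bilinear forms at integer vectors\<close>

lemma nat_binary_expansion:
  fixes a :: nat
  assumes "a < 2 ^ L"
  shows "real a = (\<Sum>i<L. 2 ^ i * of_bool (bit a i))"
proof -
  have "a = take_bit L a"
    using assms by (simp add: take_bit_nat_eq_self)
  also have "\<dots> = (\<Sum>i<L. 2 ^ i * of_bool (bit a i))"
    by (simp add: take_bit_sum push_bit_eq_mult lessThan_atLeast0 mult.commute)
  finally have "real a = real (\<Sum>i<L. 2 ^ i * of_bool (bit a i))" by simp
  then show ?thesis by (simp add: of_bool_def if_distrib cong: if_cong)
qed

text \<open>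
  The square of a sum of nonnegative numbers is at least the sum of their squares, so the square
  norms of the scaled binary layers of F add up to at most the square norm of F. Cauchy-Schwarz over
  the L layers then gives the factor sqrt L.
\<close>

lemma sum_binary_layers_le:
  fixes F :: "'a \<Rightarrow> nat"
  assumes fin: "finite U" and F: "\<And>x. x \<in> U \<Longrightarrow> F x < 2 ^ L"
  shows "(\<Sum>i<L. 2 ^ i * sqrt (card {x\<in>U. bit (F x) i})) \<le> sqrt L * L2_set (\<lambda>x. real (F x)) U"
proof -
  define s :: "nat \<Rightarrow> real" where "s i = 2 ^ i * sqrt (card {x\<in>U. bit (F x) i})" for i
  have sq: "(\<Sum>i<L. (2 ^ i * of_bool (bit (F x) i) :: real)\<^sup>2) \<le> (real (F x))\<^sup>2" if "x \<in> U" for x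
  proof -
    have "L2_set (\<lambda>i. 2 ^ i * of_bool (bit (F x) i)) {..<L} \<le> (\<Sum>i<L. 2 ^ i * of_bool (bit (F x) i))"
      by (rule L2_set_le_sum) simp
    also have "\<dots> = real (F x)" using nat_binary_expansion[OF F[OF that]] by simp
    finally show ?thesis
      unfolding L2_set_def by (metis of_nat_0_le_iff real_sqrt_abs abs_of_nat real_sqrt_le_iff)
  qed
  have "(\<Sum>i<L. (s i)\<^sup>2) = (\<Sum>i<L. \<Sum>x\<in>U. (2 ^ i * of_bool (bit (F x) i))\<^sup>2)"
  proof (rule sum.cong[OF refl])
    fix i
    have "(\<Sum>x\<in>U. (2 ^ i * of_bool (bit (F x) i) :: real)\<^sup>2) = (\<Sum>x\<in>U. if bit (F x) i then (2 ^ i)\<^sup>2 else 0)"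
      by (intro sum.cong) auto
    also have "\<dots> = (s i)\<^sup>2"
      using fin by (simp add: sum.If_cases s_def power_mult_distrib Int_def mult.commute)
    finally show "(s i)\<^sup>2 = (\<Sum>x\<in>U. (2 ^ i * of_bool (bit (F x) i))\<^sup>2)" by simp
  qed
  also have "\<dots> = (\<Sum>x\<in>U. \<Sum>i<L. (2 ^ i * of_bool (bit (F x) i))\<^sup>2)" by (rule sum.swap)
  also have "\<dots> \<le> (\<Sum>x\<in>U. (real (F x))\<^sup>2)" by (intro sum_mono sq)
  finally have le: "L2_set s {..<L} \<le> L2_set (\<lambda>x. real (F x)) U"
    unfolding L2_set_def by (rule real_sqrt_le_mono)
  have "(\<Sum>i<L. s i) = (\<Sum>i<L. \<bar>1\<bar> * \<bar>s i\<bar>)"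
    by (intro sum.cong) (auto simp: s_def)
  also have "\<dots> \<le> L2_set (\<lambda>_. 1) {..<L} * L2_set s {..<L}" by (rule L2_set_mult_ineq)
  also have "\<dots> \<le> sqrt L * L2_set (\<lambda>x. real (F x)) U"
    using le by (auto simp: L2_set_constant intro: mult_left_mono)
  finally show ?thesis by (simp add: s_def)
qed

text \<open>
  Both vectors are split into their binary layers, and the cut bound is applied to each pair of
  layers.
\<close>

lemma bilinear_bound_of_cut_bound:
  fixes E :: "'a \<Rightarrow> 'a \<Rightarrow> real" and F G :: "'a \<Rightarrow> nat"
  assumes fin: "finite U" and b: "b \<ge> 0"
    and cut: "\<And>X Y. X \<subseteq> U \<Longrightarrow> Y \<subseteq> U \<Longrightarrow> \<bar>\<Sum>x\<in>X. \<Sum>y\<in>Y. E x y\<bar> \<le> b * sqrt (card X * card Y)"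
    and F: "\<And>x. x \<in> U \<Longrightarrow> F x < 2 ^ L" and G: "\<And>x. x \<in> U \<Longrightarrow> G x < 2 ^ L"
  shows "\<bar>\<Sum>x\<in>U. \<Sum>y\<in>U. F x * E x y * G y\<bar>
           \<le> L * b * L2_set (\<lambda>x. real (F x)) U * L2_set (\<lambda>x. real (G x)) U"
proof -
  define X where "X i = {x\<in>U. bit (F x) i}" for i
  define Y where "Y i = {x\<in>U. bit (G x) i}" for i
  have "(\<Sum>x\<in>U. \<Sum>y\<in>U. F x * E x y * G y)
      = (\<Sum>x\<in>U. \<Sum>y\<in>U. \<Sum>i<L. \<Sum>j<L. 2 ^ i * 2 ^ j * (of_bool (bit (F x) i) * (of_bool (bit (G y) j) * E x y)))"
  proof (intro sum.cong refl)
    fix x y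
    assume "x \<in> U" "y \<in> U"
    then have "F x * E x y * G y = E x y * ((\<Sum>i<L. 2 ^ i * of_bool (bit (F x) i)) * (\<Sum>j<L. 2 ^ j * of_bool (bit (G y) j)))"
      using nat_binary_expansion[OF F, of x] nat_binary_expansion[OF G, of y] by simp
    also have "\<dots> = (\<Sum>i<L. \<Sum>j<L. 2 ^ i * 2 ^ j * (of_bool (bit (F x) i) * (of_bool (bit (G y) j) * E x y)))"
      unfolding sum_product unfolding sum_distrib_left by (intro sum.cong refl) (simp only: mult_ac)
    finally show "F x * E x y * G y = \<dots>" .
  qed
  also have "\<dots> = (\<Sum>i<L. \<Sum>j<L. \<Sum>x\<in>U. \<Sum>y\<in>U. 2 ^ i * 2 ^ j * (of_bool (bit (F x) i) * (of_bool (bit (G y) j) * E x y)))"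
  proof -
    have "(\<Sum>x\<in>U. \<Sum>y\<in>U. \<Sum>i<L. \<Sum>j<L. g x y i j) = (\<Sum>i<L. \<Sum>j<L. \<Sum>x\<in>U. \<Sum>y\<in>U. g x y i j)"
      for g :: "'a \<Rightarrow> 'a \<Rightarrow> nat \<Rightarrow> nat \<Rightarrow> real"
      unfolding sum.cartesian_product
      by (rule sum.reindex_bij_witness[where i = "\<lambda>(i,j,x,y). (x,y,i,j)" and j = "\<lambda>(x,y,i,j). (i,j,x,y)"]) auto
    then show ?thesis .
  qed
  also have "\<dots> = (\<Sum>i<L. \<Sum>j<L. 2 ^ i * 2 ^ j * (\<Sum>x\<in>X i. \<Sum>y\<in>Y j. E x y))"
  proof (intro sum.cong refl)
    fix i j
    have "(\<Sum>x\<in>X i. \<Sum>y\<in>Y j. E x y) = (\<Sum>x\<in>X i. \<Sum>y\<in>U. of_bool (bit (G y) j) * E x y)"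
      unfolding Y_def by (intro sum.cong sum.mono_neutral_cong_left) (auto simp: fin)
    also have "\<dots> = (\<Sum>x\<in>U. of_bool (bit (F x) i) * (\<Sum>y\<in>U. of_bool (bit (G y) j) * E x y))"
      unfolding X_def by (intro sum.mono_neutral_cong_left) (auto simp: fin)
    finally show "(\<Sum>x\<in>U. \<Sum>y\<in>U. 2 ^ i * 2 ^ j * (of_bool (bit (F x) i) * (of_bool (bit (G y) j) * E x y)))
        = 2 ^ i * 2 ^ j * (\<Sum>x\<in>X i. \<Sum>y\<in>Y j. E x y)"
      by (simp add: sum_distrib_left mult_ac)
  qed
  finally have eq: "(\<Sum>x\<in>U. \<Sum>y\<in>U. F x * E x y * G y)
      = (\<Sum>i<L. \<Sum>j<L. 2 ^ i * 2 ^ j * (\<Sum>x\<in>X i. \<Sum>y\<in>Y j. E x y))" .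
  have cut': "\<bar>\<Sum>x\<in>X i. \<Sum>y\<in>Y j. E x y\<bar> \<le> b * sqrt (card (X i) * card (Y j))" for i j
    by (rule cut) (auto simp: X_def Y_def)
  have "\<bar>\<Sum>x\<in>U. \<Sum>y\<in>U. F x * E x y * G y\<bar> \<le> (\<Sum>i<L. \<Sum>j<L. 2 ^ i * 2 ^ j * (b * sqrt (card (X i) * card (Y j))))"
    unfolding eq
    by (rule order_trans[OF sum_abs sum_mono], rule order_trans[OF sum_abs sum_mono], simp add: abs_mult mult_left_mono cut' del: of_nat_mult)
  also have "\<dots> = b * ((\<Sum>i<L. 2 ^ i * sqrt (card (X i))) * (\<Sum>i<L. 2 ^ i * sqrt (card (Y i))))"
    unfolding sum_product unfolding sum_distrib_left
    by (intro sum.cong refl) (simp add: real_sqrt_mult mult_ac)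
  also have "\<dots> \<le> b * ((sqrt L * L2_set (\<lambda>x. real (F x)) U) * (sqrt L * L2_set (\<lambda>x. real (G x)) U))"
    unfolding X_def Y_def
    by (intro mult_left_mono mult_mono sum_binary_layers_le fin F G b) (auto simp: sum_nonneg)
  also have "\<dots> = L * b * L2_set (\<lambda>x. real (F x)) U * L2_set (\<lambda>x. real (G x)) U"
    by (simp add: mult_ac)
  finally show ?thesis .
qed

section \<open>Powers of a matrix indexed by a set\<close>

primrec mpow :: "'a set \<Rightarrow> ('a \<Rightarrow> 'a \<Rightarrow> real) \<Rightarrow> nat \<Rightarrow> 'a \<Rightarrow> 'a \<Rightarrow> real" where
  "mpow U M 0 x y = of_bool (x = y)"
| "mpow U M (Suc j) x y = (\<Sum>z\<in>U. M x z * mpow U M j z y)"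

lemma mpow_add:
  assumes "finite U" "x \<in> U"
  shows "mpow U M (i + j) x y = (\<Sum>z\<in>U. mpow U M i x z * mpow U M j z y)"
  using assms(2)
proof (induction i arbitrary: x)
  case 0
  then have "(\<Sum>z\<in>U. of_bool (x = z) * mpow U M j z y) = (\<Sum>z\<in>{x}. mpow U M j z y)"
    using assms(1) by (intro sum.mono_neutral_cong_right) auto
  then show ?case by simp
next
  case (Suc i)
  have "mpow U M (Suc i + j) x y = (\<Sum>w\<in>U. M x w * (\<Sum>z\<in>U. mpow U M i w z * mpow U M j z y))"
    using Suc.IH by simp
  also have "\<dots> = (\<Sum>w\<in>U. \<Sum>z\<in>U. M x w * (mpow U M i w z * mpow U M j z y))"
    by (simp add: sum_distrib_left)
  also have "\<dots> = (\<Sum>z\<in>U. \<Sum>w\<in>U. M x w * (mpow U M i w z * mpow U M j z y))"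
    by (rule sum.swap)
  finally show ?case by (simp add: sum_distrib_right mult.assoc)
qed

lemma mpow_1:
  assumes "finite U" "y \<in> U"
  shows "mpow U M (Suc 0) x y = M x y"
proof -
  have "(\<Sum>z\<in>U. M x z * of_bool (z = y)) = (\<Sum>z\<in>{y}. M x z)"
    using assms by (intro sum.mono_neutral_cong_right) auto
  then show ?thesis by simp
qed

lemma mpow_Suc_right:
  assumes "finite U" "x \<in> U" "y \<in> U"
  shows "mpow U M (Suc j) x y = (\<Sum>z\<in>U. mpow U M j x z * M z y)"
proof -
  have "mpow U M (j + Suc 0) x y = (\<Sum>z\<in>U. mpow U M j x z * mpow U M (Suc 0) z y)"
    by (rule mpow_add[OF assms(1,2)])
  also have "\<dots> = (\<Sum>z\<in>U. mpow U M j x z * M z y)"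
    using mpow_1[OF assms(1,3)] by metis
  finally show ?thesis by simp
qed

lemma mpow_sym:
  assumes "finite U" "\<And>x y. x \<in> U \<Longrightarrow> y \<in> U \<Longrightarrow> M x y = M y x" "x \<in> U" "y \<in> U"
  shows "mpow U M j x y = mpow U M j y x"
  using assms(3,4)
proof (induction j arbitrary: x y)
  case (Suc j)
  have "mpow U M (Suc j) x y = (\<Sum>z\<in>U. mpow U M j y z * M z x)"
    using Suc assms(2) by (auto intro!: sum.cong simp: mult.commute)
  also have "\<dots> = mpow U M (Suc j) y x"
    using mpow_Suc_right[OF assms(1)] Suc.prems by metis
  finally show ?case .
qed auto

lemma mpow_nonneg:
  assumes "\<And>x y. x \<in> U \<Longrightarrow> y \<in> U \<Longrightarrow> M x y \<ge> 0" "x \<in> U"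
  shows "mpow U M j x y \<ge> 0"
  using assms(2)
  by (induction j arbitrary: x) (auto intro!: sum_nonneg mult_nonneg_nonneg assms(1))

lemma mpow_mono:
  assumes "\<And>x y. x \<in> U \<Longrightarrow> y \<in> U \<Longrightarrow> 0 \<le> M x y \<and> M x y \<le> M' x y" "x \<in> U"
  shows "mpow U M j x y \<le> mpow U M' j x y"
  using assms(2)
proof (induction j arbitrary: x)
  case (Suc j)
  have "0 \<le> mpow U M j z y" if "z \<in> U" for z
    using that assms(1) by (intro mpow_nonneg) auto
  with Suc assms(1) show ?case
    by (auto intro!: sum_mono mult_mono intro: order_trans)
qed simp

lemma sum_in_Nats:
  fixes g :: "'a \<Rightarrow> real"
  assumes "\<And>x. x \<in> U \<Longrightarrow> g x \<in> \<nat>"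
  shows "sum g U \<in> \<nat>"
  using assms by (induction U rule: infinite_finite_induct) auto

lemma mpow_in_Nats:
  assumes "\<And>x y. x \<in> U \<Longrightarrow> y \<in> U \<Longrightarrow> M x y \<in> \<nat>" "x \<in> U"
  shows "mpow U M j x y \<in> \<nat>"
  using assms(2)
proof (induction j arbitrary: x)
  case (Suc j)
  with assms(1) show ?case by (auto intro!: sum_in_Nats)
qed auto

lemma mpow_le_card_power:
  assumes "finite U" "\<And>x y. x \<in> U \<Longrightarrow> y \<in> U \<Longrightarrow> 0 \<le> M x y \<and> M x y \<le> 1" "x \<in> U" "y \<in> U"
  shows "mpow U M (Suc j) x y \<le> real (card U) ^ j"
  using assms(3)
proof (induction j arbitrary: x)
  case 0
  then show ?case using mpow_1[OF assms(1,4), of M x] assms by simp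
next
  case (Suc j)
  have "mpow U M (Suc (Suc j)) x y = (\<Sum>z\<in>U. M x z * mpow U M (Suc j) z y)" by simp
  also have "\<dots> \<le> (\<Sum>z\<in>U. 1 * real (card U) ^ j)"
    using Suc assms by (intro sum_mono mult_mono Suc.IH mpow_nonneg) auto
  finally show ?case by simp
qed

lemma mpow_row_sum_le:
  assumes "\<And>x y. x \<in> U \<Longrightarrow> y \<in> U \<Longrightarrow> 0 \<le> M x y" "\<And>x. x \<in> U \<Longrightarrow> (\<Sum>y\<in>U. M x y) \<le> \<Delta>"
    and "finite U" "x \<in> U"
  shows "(\<Sum>y\<in>U. mpow U M j x y) \<le> \<Delta> ^ j"
  using assms(4)
proof (induction j arbitrary: x)
  case 0
  then have "(\<Sum>y\<in>U. of_bool (x = y)) = (\<Sum>y\<in>{x}. 1::real)"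
    using assms(3) by (intro sum.mono_neutral_cong_right) auto
  then show ?case by simp
next
  case (Suc j)
  have D: "\<Delta> \<ge> 0" using assms(2)[OF Suc.prems] sum_nonneg[of U "M x"] assms(1) Suc.prems
    by fastforce
  have "(\<Sum>y\<in>U. mpow U M (Suc j) x y) = (\<Sum>z\<in>U. \<Sum>y\<in>U. M x z * mpow U M j z y)"
    by (simp, rule sum.swap)
  also have "\<dots> = (\<Sum>z\<in>U. M x z * (\<Sum>y\<in>U. mpow U M j z y))"
    by (simp add: sum_distrib_left)
  also have "\<dots> \<le> (\<Sum>z\<in>U. M x z * \<Delta> ^ j)"
    using Suc assms by (intro sum_mono mult_left_mono) auto
  also have "\<dots> \<le> \<Delta> * \<Delta> ^ j"
    using assms(2)[OF Suc.prems] D by (simp add: mult_right_mono flip: sum_distrib_right)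
  finally show ?case by simp
qed

section \<open>Closed walks with a repeated vertex\<close>

definition walk_lists :: "'a set \<Rightarrow> ('a \<Rightarrow> 'a \<Rightarrow> bool) \<Rightarrow> nat \<Rightarrow> 'a \<Rightarrow> 'a \<Rightarrow> 'a list set" where
  "walk_lists U R n x y = {xs. length xs = Suc n \<and> set xs \<subseteq> U \<and> xs ! 0 = x \<and> xs ! n = y \<and>
     (\<forall>i<n. R (xs ! i) (xs ! Suc i))}"

lemma finite_walk_lists:
  assumes "finite U"
  shows "finite (walk_lists U R n x y)"
  by (rule finite_subset[OF _ finite_lists_length_eq[OF assms, of "Suc n"]]) (auto simp: walk_lists_def)

lemma mpow_eq_card_walk_lists:
  assumes fin: "finite U" and "x \<in> U" "y \<in> U"
  shows "mpow U (\<lambda>x y. of_bool (R x y)) n x y = card (walk_lists U R n x y)"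
  using assms(2)
proof (induction n arbitrary: x)
  case 0
  have "walk_lists U R 0 x y = (if x = y then {[x]} else {})"
    using 0 by (auto simp: walk_lists_def length_Suc_conv)
  then show ?case by simp
next
  case (Suc n)
  have eq: "walk_lists U R (Suc n) x y = (\<Union>z\<in>{z\<in>U. R x z}. (#) x ` walk_lists U R n z y)" (is "?L = ?R")
  proof
    show "?R \<subseteq> ?L"
    proof
      fix xs assume "xs \<in> ?R"
      then obtain z ys where ys: "z \<in> U" "R x z" "ys \<in> walk_lists U R n z y" "xs = x # ys" by auto
      have "R (xs ! i) (xs ! Suc i)" if "i < Suc n" for i
        using ys that by (cases i) (auto simp: walk_lists_def)
      then show "xs \<in> ?L" using ys Suc.prems by (auto simp: walk_lists_def)
    qed
    show "?L \<subseteq> ?R"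
    proof
      fix xs assume xs: "xs \<in> ?L"
      then obtain ys where ys: "xs = x # ys" "length ys = Suc n"
        by (auto simp: walk_lists_def length_Suc_conv)
      have "R (ys ! i) (ys ! Suc i)" if "i < n" for i
        using xs that unfolding walk_lists_def ys(1) by fastforce
      then have "ys \<in> walk_lists U R n (ys ! 0) y"
        using xs ys unfolding walk_lists_def by auto
      moreover have "R x (ys ! 0)" "ys ! 0 \<in> U"
        using xs ys unfolding walk_lists_def by auto
      ultimately show "xs \<in> ?R" using ys by blast
    qed
  qed
  have "card ?L = (\<Sum>z\<in>{z\<in>U. R x z}. card ((#) x ` walk_lists U R n z y))"
    unfolding eq using fin
    by (intro card_UN_disjoint) (auto simp: finite_walk_lists, auto simp: walk_lists_def)
  also have "\<dots> = (\<Sum>z\<in>{z\<in>U. R x z}. card (walk_lists U R n z y))"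
    by (intro sum.cong refl card_image) auto
  finally have "real (card ?L) = (\<Sum>z\<in>{z\<in>U. R x z}. mpow U (\<lambda>x y. of_bool (R x y)) n z y)"
    using Suc.IH by simp
  also have "\<dots> = (\<Sum>z\<in>U. of_bool (R x z) * mpow U (\<lambda>x y. of_bool (R x y)) n z y)"
    using fin by (intro sum.mono_neutral_cong_left) auto
  finally show ?case by simp
qed

text \<open>
  Cutting the walk at positions i and j gives three walks, and together they determine it.
\<close>

lemma card_walks_through_le:
  assumes fin: "finite U" and ij: "i < j" "j < n"
  shows "card {xs \<in> walk_lists U R n x y. xs ! i = z \<and> xs ! j = z}
    \<le> card (walk_lists U R i x z) * card (walk_lists U R (j - i) z z) * card (walk_lists U R (n - j) z y)"
proof -
  let ?D = "{xs \<in> walk_lists U R n x y. xs ! i = z \<and> xs ! j = z}"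
  let ?f = "\<lambda>xs. ((take (Suc i) xs, take (Suc (j - i)) (drop i xs)), drop j xs)"
  let ?T = "(walk_lists U R i x z \<times> walk_lists U R (j - i) z z) \<times> walk_lists U R (n - j) z y"
  have "inj_on ?f ?D"
  proof (rule inj_onI)
    fix xs ys assume xs: "xs \<in> ?D" and ys: "ys \<in> ?D" and eq: "?f xs = ?f ys"
    have "xs ! l = ys ! l" if "l < Suc n" for l
    proof -
      consider "l < Suc i" | "i \<le> l" "l \<le> j" | "j \<le> l" by linarith
      then show ?thesis
      proof cases
        case 1
        with eq have "take (Suc i) xs ! l = take (Suc i) ys ! l" by simp
        with 1 show ?thesis by simp
      next
        case 2
        then obtain r where r: "l = i + r" "r < Suc (j - i)"
          by (metis le_add_diff_inverse diff_le_mono le_imp_less_Suc)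
        from eq have "take (Suc (j - i)) (drop i xs) ! r = take (Suc (j - i)) (drop i ys) ! r" by simp
        with r xs ys ij show ?thesis by (simp add: walk_lists_def)
      next
        case 3
        then obtain r where r: "l = j + r" using le_Suc_ex by blast
        from eq have "drop j xs ! r = drop j ys ! r" by simp
        with r xs ys ij show ?thesis by (simp add: walk_lists_def)
      qed
    qed
    then show "xs = ys" using xs ys by (auto simp: walk_lists_def intro!: nth_equalityI)
  qed
  moreover have "?f ` ?D \<subseteq> ?T"
  proof
    fix t assume "t \<in> ?f ` ?D"
    then obtain xs where xs: "xs \<in> ?D" and t: "t = ?f xs" by blast
    from xs have len: "length xs = Suc n" and sub: "set xs \<subseteq> U" and ends: "xs ! 0 = x" "xs ! n = y"
      "xs ! i = z" "xs ! j = z" and R: "\<And>l. l < n \<Longrightarrow> R (xs ! l) (xs ! Suc l)"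
      by (auto simp: walk_lists_def)
    have "take (Suc i) xs \<in> walk_lists U R i x z"
      using len sub ends R ij by (auto simp: walk_lists_def dest: in_set_takeD)
    moreover have "take (Suc (j - i)) (drop i xs) \<in> walk_lists U R (j - i) z z"
      using len sub ends R[of "i + _"] ij
      by (auto simp: walk_lists_def dest: in_set_takeD in_set_dropD)
    moreover have "drop j xs \<in> walk_lists U R (n - j) z y"
      using len sub ends R[of "j + _"] ij by (auto simp: walk_lists_def dest: in_set_dropD)
    ultimately show "t \<in> ?T" unfolding t by blast
  qed
  moreover have "finite ?T" by (intro finite_cartesian_product finite_walk_lists fin)
  ultimately have "card ?D \<le> card ?T" by (rule card_inj_on_le)
  then show ?thesis by (simp add: card_cartesian_product)
qed

text \<open>
  If no closed walk of length L is a cycle, each of them visits some vertex z at two positions i < j.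
  It is then a closed walk at z of length j - i together with one of length L - (j - i), the latter
  passing through the starting point of the original walk. As there are no loops, both lengths are at
  least 2.
\<close>

lemma closed_walks_le_sum_degenerate:
  fixes R :: "'a \<Rightarrow> 'a \<Rightarrow> bool" and L :: nat
  assumes fin: "finite U" and irrefl: "\<And>x. x \<in> U \<Longrightarrow> \<not> R x x"
    and no_cycle: "\<And>x xs. xs \<in> walk_lists U R L x x \<Longrightarrow> \<not> distinct (take L xs)"
  defines "M \<equiv> \<lambda>x y. of_bool (R x y)"
  shows "(\<Sum>x\<in>U. mpow U M L x x)
    \<le> (\<Sum>(i, j)\<in>{(i, j). i + 2 \<le> j \<and> j < L \<and> j - i + 2 \<le> L}. \<Sum>z\<in>U. mpow U M (j - i) z z * mpow U M (L - (j - i)) z z)"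
    (is "_ \<le> sum _ ?I")
proof -
  have finI: "finite ?I"
    by (rule finite_subset[of _ "{..L} \<times> {..L}"]) auto
  define D where "D x t z = {xs \<in> walk_lists U R L x x. xs ! fst t = z \<and> xs ! snd t = z}" for x t z
  let ?w = "walk_lists U R"
  have finD: "finite (D x t z)" for x t z
    unfolding D_def by (rule finite_subset[OF _ finite_walk_lists[OF fin, of R L x x]]) auto
  have cover: "?w L x x \<subseteq> (\<Union>t\<in>?I. \<Union>z\<in>U. D x t z)" for x
  proof
    fix xs assume xs: "xs \<in> ?w L x x"
    from xs have len: "length xs = Suc L" and sub: "set xs \<subseteq> U" and ends: "xs ! 0 = x" "xs ! L = x"
      and R: "\<And>l. l < L \<Longrightarrow> R (xs ! l) (xs ! Suc l)" by (auto simp: walk_lists_def)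
    have U: "xs ! l \<in> U" if "l \<le> L" for l using sub len that by (metis le_imp_less_Suc nth_mem subsetD)
    from no_cycle[OF xs] obtain i j where ij: "i < j" "j < L" "xs ! i = xs ! j"
      using len unfolding distinct_conv_nth by (auto simp: nat_neq_iff)
    have "j \<noteq> Suc i" using irrefl[OF U, of i] R[of i] ij by auto
    moreover have "\<not> (i = 0 \<and> Suc j = L)"
      using irrefl[OF U, of j] R[of j] ij ends by auto
    ultimately have "(i, j) \<in> ?I" using ij by auto
    moreover have "xs \<in> D x (i, j) (xs ! j)" using xs ij by (simp add: D_def)
    ultimately show "xs \<in> (\<Union>t\<in>?I. \<Union>z\<in>U. D x t z)" using U[of j] ij by fastforce
  qed
  have card_D: "real (card (D x t z)) \<le> mpow U M (fst t) x z * mpow U M (snd t - fst t) z z * mpow U M (L - snd t) z x"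
    if "x \<in> U" "z \<in> U" "t \<in> ?I" for x z t
  proof -
    have "card (D x t z) \<le> card (?w (fst t) x z) * card (?w (snd t - fst t) z z) * card (?w (L - snd t) z x)"
      unfolding D_def using that by (intro card_walks_through_le fin) auto
    then have "real (card (D x t z)) \<le> real (card (?w (fst t) x z) * card (?w (snd t - fst t) z z) * card (?w (L - snd t) z x))"
      by (simp only: of_nat_le_iff)
    then show ?thesis unfolding M_def using mpow_eq_card_walk_lists[OF fin, of _ _ R] that by simp
  qed
  have "(\<Sum>x\<in>U. mpow U M L x x) \<le> (\<Sum>x\<in>U. \<Sum>t\<in>?I. \<Sum>z\<in>U.
      mpow U M (fst t) x z * mpow U M (snd t - fst t) z z * mpow U M (L - snd t) z x)"
  proof (rule sum_mono)
    fix x assume x: "x \<in> U"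
    have "card (?w L x x) \<le> card (\<Union>t\<in>?I. \<Union>z\<in>U. D x t z)"
      by (rule card_mono[OF _ cover]) (intro finite_UN_I finI fin finD)
    also have "\<dots> \<le> (\<Sum>t\<in>?I. card (\<Union>z\<in>U. D x t z))" by (rule card_UN_le[OF finI])
    also have "\<dots> \<le> (\<Sum>t\<in>?I. \<Sum>z\<in>U. card (D x t z))" by (intro sum_mono card_UN_le[OF fin])
    finally have "real (card (?w L x x)) \<le> real (\<Sum>t\<in>?I. \<Sum>z\<in>U. card (D x t z))"
      by (simp only: of_nat_le_iff)
    also have "\<dots> = (\<Sum>t\<in>?I. \<Sum>z\<in>U. real (card (D x t z)))" by simp
    also have "\<dots> \<le> (\<Sum>t\<in>?I. \<Sum>z\<in>U. mpow U M (fst t) x z * mpow U M (snd t - fst t) z z * mpow U M (L - snd t) z x)"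
      by (intro sum_mono card_D x)
    finally show "mpow U M L x x \<le> \<dots>"
      unfolding M_def using mpow_eq_card_walk_lists[OF fin x x, of R L] by simp
  qed
  also have "\<dots> = (\<Sum>t\<in>?I. \<Sum>x\<in>U. \<Sum>z\<in>U. mpow U M (fst t) x z * mpow U M (snd t - fst t) z z * mpow U M (L - snd t) z x)"
    by (rule sum.swap)
  also have "\<dots> = (\<Sum>t\<in>?I. \<Sum>z\<in>U. \<Sum>x\<in>U. mpow U M (fst t) x z * mpow U M (snd t - fst t) z z * mpow U M (L - snd t) z x)"
    by (intro sum.cong refl sum.swap)
  also have "\<dots> = (\<Sum>t\<in>?I. \<Sum>z\<in>U. mpow U M (snd t - fst t) z z * mpow U M (L - (snd t - fst t)) z z)"
  proof (intro sum.cong refl)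
    fix t z assume t: "t \<in> ?I" and z: "z \<in> U"
    have e: "L - (snd t - fst t) = (L - snd t) + fst t" using t by auto
    show "(\<Sum>x\<in>U. mpow U M (fst t) x z * mpow U M (snd t - fst t) z z * mpow U M (L - snd t) z x)
        = mpow U M (snd t - fst t) z z * mpow U M (L - (snd t - fst t)) z z"
      unfolding e mpow_add[OF fin z] sum_distrib_left by (intro sum.cong refl) (simp only: mult_ac)
  qed
  finally show ?thesis by (simp add: case_prod_unfold)
qed

section \<open>Spreading of walks in a pseudorandom graph\<close>

lemma absorb_le:
  fixes X Y c :: real
  assumes "0 \<le> X" "0 \<le> Y" "1 \<le> c"
  shows "2 * X + 2 * c * (X + Y) \<le> 4 * c * (X + Y)" and "X + c * (X + Y) \<le> 4 * c * (X + Y)"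
proof -
  have "0 \<le> (c - 1) * X" "0 \<le> (c - 1) * Y" using assms by auto
  with assms show "2 * X + 2 * c * (X + Y) \<le> 4 * c * (X + Y)" "X + c * (X + Y) \<le> 4 * c * (X + Y)"
    by (simp_all add: algebra_simps)
qed

text \<open>
  The bilinear form of B - p J is controlled only at natural-valued vectors with entries up to
  m^(k-1), where m is the number of vertices. These include the columns of the first k powers of B,
  and they are 0/1-vectors if k = 1; hence this form of the hypothesis costs no logarithm for
  triangles.
\<close>

locale pseudorandom_matrix =
  fixes U :: "'a set" and B :: "'a \<Rightarrow> 'a \<Rightarrow> real" and p b \<Delta> :: real and k :: nat
  assumes fin: "finite U" and ne: "U \<noteq> {}"
    and B_sym: "\<And>x y. x \<in> U \<Longrightarrow> y \<in> U \<Longrightarrow> B x y = B y x"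
    and B_01: "\<And>x y. x \<in> U \<Longrightarrow> y \<in> U \<Longrightarrow> B x y \<in> {0, 1}"
    and p_nonneg: "0 \<le> p" and b_nonneg: "0 \<le> b" and k_pos: "1 \<le> k"
    and deg: "\<And>x. x \<in> U \<Longrightarrow> (\<Sum>y\<in>U. B x y) \<le> \<Delta>"
    and p_le: "p * card U \<le> \<Delta>" and b_le: "b \<le> \<Delta>"
    and bilinear: "\<And>f g :: 'a \<Rightarrow> real. \<lbrakk>\<And>x. x \<in> U \<Longrightarrow> f x \<in> \<nat> \<and> f x \<le> real (card U) ^ (k - 1);
        \<And>x. x \<in> U \<Longrightarrow> g x \<in> \<nat> \<and> g x \<le> real (card U) ^ (k - 1)\<rbrakk>
        \<Longrightarrow> \<bar>\<Sum>x\<in>U. \<Sum>y\<in>U. f x * (B x y - p) * g y\<bar> \<le> b * L2_set f U * L2_set g U"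
begin

definition small :: "('a \<Rightarrow> real) \<Rightarrow> bool" where
  "small f \<longleftrightarrow> (\<forall>x\<in>U. f x \<in> \<nat> \<and> f x \<le> real (card U) ^ (k - 1))"

lemma small_nonneg: "small f \<Longrightarrow> x \<in> U \<Longrightarrow> 0 \<le> f x"
  unfolding small_def Nats_def by auto

lemma card_ge_1: "1 \<le> real (card U)"
  using fin ne by (simp add: Suc_leI card_gt_0_iff)

lemma \<Delta>_nonneg: "0 \<le> \<Delta>"
  using b_nonneg b_le by linarith

lemma small_form:
  assumes "small f" "small g"
  shows "\<bar>(\<Sum>x\<in>U. \<Sum>y\<in>U. f x * B x y * g y) - p * sum f U * sum g U\<bar> \<le> b * L2_set f U * L2_set g U"
proof -
  have "(\<Sum>x\<in>U. \<Sum>y\<in>U. f x * (B x y - p) * g y)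
      = (\<Sum>x\<in>U. \<Sum>y\<in>U. f x * B x y * g y) - (\<Sum>x\<in>U. \<Sum>y\<in>U. p * (f x * g y))"
    by (simp add: sum_subtractf algebra_simps)
  also have "(\<Sum>x\<in>U. \<Sum>y\<in>U. p * (f x * g y)) = p * sum f U * sum g U"
    unfolding mult.assoc sum_product unfolding sum_distrib_left ..
  finally show ?thesis using bilinear[of f g] assms unfolding small_def by simp
qed

lemma sum_le_L2:
  assumes "small f"
  shows "sum f U \<le> sqrt (card U) * L2_set f U"
proof -
  have "sum f U = (\<Sum>x\<in>U. \<bar>1\<bar> * \<bar>f x\<bar>)"
    using small_nonneg[OF assms] by (intro sum.cong) auto
  also have "\<dots> \<le> L2_set (\<lambda>_. 1) U * L2_set f U" by (rule L2_set_mult_ineq)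
  finally show ?thesis by (simp add: L2_set_constant)
qed

text \<open>
  One step of a walk: the component of f along the constant vector is scaled by p m, and the rest by
  b. The square norm of g is read as the inner product of g with B f, and not E f but B f occurs
  there because the bilinear bound is available only for nonnegative vectors.
\<close>

lemma L2_set_step:
  assumes f: "small f" and g: "small g" and gf: "\<And>x. x \<in> U \<Longrightarrow> g x = (\<Sum>y\<in>U. B x y * f y)"
  shows "(\<Sum>x\<in>U. (g x)\<^sup>2) \<le> 2 * (p\<^sup>2 * card U * (sum f U)\<^sup>2) + 2 * (b\<^sup>2 * (\<Sum>x\<in>U. (f x)\<^sup>2))"
proof -
  have sf: "0 \<le> sum f U" using small_nonneg[OF f] by (intro sum_nonneg) auto
  have L2sq: "(L2_set h U)\<^sup>2 = (\<Sum>x\<in>U. (h x)\<^sup>2)" for h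
    by (simp add: L2_set_def sum_nonneg)
  have "(L2_set g U)\<^sup>2 = (\<Sum>x\<in>U. \<Sum>y\<in>U. g x * B x y * f y)"
    unfolding L2sq
    by (intro sum.cong refl) (simp add: power2_eq_square gf sum_distrib_left mult.assoc)
  also have "\<dots> \<le> p * sum g U * sum f U + b * L2_set g U * L2_set f U"
    using small_form[OF g f] by linarith
  also have "\<dots> \<le> p * (sqrt (card U) * L2_set g U) * sum f U + b * L2_set g U * L2_set f U"
    using sum_le_L2[OF g] sf p_nonneg by (intro add_right_mono mult_right_mono mult_left_mono) auto
  finally have *: "L2_set g U * L2_set g U \<le> L2_set g U * (p * sqrt (card U) * sum f U + b * L2_set f U)"
    by (simp add: power2_eq_square algebra_simps)
  have "L2_set g U \<le> p * sqrt (card U) * sum f U + b * L2_set f U"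
  proof (cases "L2_set g U = 0")
    case True
    then show ?thesis using sf p_nonneg b_nonneg by simp
  next
    case False
    then have "L2_set g U > 0" using L2_set_nonneg[of g U] by linarith
    with * show ?thesis by simp
  qed
  then have "(L2_set g U)\<^sup>2 \<le> (p * sqrt (card U) * sum f U + b * L2_set f U)\<^sup>2"
    by (intro power_mono) auto
  also have "\<dots> \<le> 2 * (p * sqrt (card U) * sum f U)\<^sup>2 + 2 * (b * L2_set f U)\<^sup>2"
    by (smt (verit) power2_diff power2_sum zero_le_power2)
  finally show ?thesis by (simp add: power_mult_distrib L2sq)
qed

lemma B_bounds: "x \<in> U \<Longrightarrow> y \<in> U \<Longrightarrow> 0 \<le> B x y \<and> B x y \<le> 1"
  using B_01[of x y] by auto

lemma small_mpow_col:
  assumes "z \<in> U" "i < k"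
  shows "small (\<lambda>x. mpow U B (Suc i) x z)"
  unfolding small_def
proof (intro ballI conjI)
  fix x assume x: "x \<in> U"
  show "mpow U B (Suc i) x z \<in> \<nat>"
    by (rule mpow_in_Nats[OF _ x]) (use B_01 in fastforce)
  have "mpow U B (Suc i) x z \<le> real (card U) ^ i"
    by (rule mpow_le_card_power[OF fin B_bounds x assms(1)])
  also have "\<dots> \<le> real (card U) ^ (k - 1)"
    using assms(2) card_ge_1 by (intro power_increasing) auto
  finally show "mpow U B (Suc i) x z \<le> real (card U) ^ (k - 1)" .
qed

lemma sum_mpow_col_le:
  assumes "z \<in> U"
  shows "(\<Sum>x\<in>U. mpow U B i x z) \<le> \<Delta> ^ i"
proof -
  have "(\<Sum>x\<in>U. mpow U B i x z) = (\<Sum>x\<in>U. mpow U B i z x)"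
    by (intro sum.cong refl mpow_sym fin B_sym assms)
  also have "\<dots> \<le> \<Delta> ^ i"
    using B_bounds deg fin assms by (intro mpow_row_sum_le) auto
  finally show ?thesis .
qed

lemma sum_mpow_col_nonneg: "0 \<le> (\<Sum>x\<in>U. mpow U B i x z)"
  using B_bounds by (intro sum_nonneg mpow_nonneg) auto

text \<open>
  The first summand is the contribution of a perfectly equidistributed walk. The second one starts
  from the square norm of a neighbourhood, which is at most \<Delta>, and gains only b^2 with each further
  step; a bound by \<Delta>^2 in each step would lose the exponent of p in the theorem.
\<close>

lemma sum_sq_mpow_col_le:
  assumes "z \<in> U" "i < k"
  shows "(\<Sum>x\<in>U. (mpow U B (Suc i) x z)\<^sup>2) \<le> 4 ^ Suc i * (\<Delta> ^ (2 * i + 2) / card U + b ^ (2 * i) * \<Delta>)"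
  using assms(2)
proof (induction i)
  case 0
  have "(\<Sum>x\<in>U. (mpow U B (Suc 0) x z)\<^sup>2) = (\<Sum>x\<in>U. B z x)"
  proof (rule sum.cong[OF refl])
    fix x assume x: "x \<in> U"
    show "(mpow U B (Suc 0) x z)\<^sup>2 = B z x"
      using mpow_1[OF fin assms(1), of B x] B_01[OF x assms(1)] B_sym[OF x assms(1)] by auto
  qed
  also have "\<dots> \<le> \<Delta>" by (rule deg[OF assms(1)])
  also have "\<dots> \<le> 4 ^ Suc 0 * (\<Delta> ^ (2 * 0 + 2) / card U + b ^ (2 * 0) * \<Delta>)"
    using \<Delta>_nonneg by simp
  finally show ?case .
next
  case (Suc i)
  let ?m = "real (card U)"
  have "(\<Sum>x\<in>U. (mpow U B (Suc (Suc i)) x z)\<^sup>2)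
      \<le> 2 * (p\<^sup>2 * ?m * (\<Sum>x\<in>U. mpow U B (Suc i) x z)\<^sup>2) + 2 * (b\<^sup>2 * (\<Sum>x\<in>U. (mpow U B (Suc i) x z)\<^sup>2))"
    using Suc.prems assms(1) by (intro L2_set_step small_mpow_col) auto
  also have "\<dots> \<le> 2 * (\<Delta>\<^sup>2 / ?m * (\<Delta> ^ Suc i)\<^sup>2) + 2 * (b\<^sup>2 * (4 ^ Suc i * (\<Delta> ^ (2 * i + 2) / ?m + b ^ (2 * i) * \<Delta>)))"
  proof (intro add_mono mult_left_mono mult_mono Suc.IH)
    have "p\<^sup>2 * ?m = (p * ?m)\<^sup>2 / ?m"
      using card_ge_1 by (simp add: power2_eq_square field_simps)
    also have "\<dots> \<le> \<Delta>\<^sup>2 / ?m"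
      using p_le p_nonneg by (intro divide_right_mono power_mono) auto
    finally show "p\<^sup>2 * ?m \<le> \<Delta>\<^sup>2 / ?m" .
    show "(\<Sum>x\<in>U. mpow U B (Suc i) x z)\<^sup>2 \<le> (\<Delta> ^ Suc i)\<^sup>2"
      by (intro power_mono sum_mpow_col_le[OF assms(1)] sum_mpow_col_nonneg)
  qed (use Suc.prems in auto)
  also have "\<dots> \<le> 2 * (\<Delta> ^ (2 * Suc i + 2) / ?m) + 2 * 4 ^ Suc i * (\<Delta> ^ (2 * Suc i + 2) / ?m + b ^ (2 * Suc i) * \<Delta>)"
  proof -
    have "b\<^sup>2 * \<Delta> ^ (2 * i + 2) \<le> \<Delta>\<^sup>2 * \<Delta> ^ (2 * i + 2)"
      using b_nonneg b_le \<Delta>_nonneg by (intro mult_right_mono power_mono) auto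
    then have "b\<^sup>2 * \<Delta> ^ (2 * i + 2) / ?m \<le> \<Delta> ^ (2 * Suc i + 2) / ?m"
      by (intro divide_right_mono) (auto simp: power_add power2_eq_square mult_ac)
    then have X: "b\<^sup>2 * (\<Delta> ^ (2 * i + 2) / ?m) \<le> \<Delta> ^ (2 * Suc i + 2) / ?m"
      by (simp only: times_divide_eq_right)
    have "\<Delta>\<^sup>2 * (\<Delta> ^ Suc i)\<^sup>2 = \<Delta> ^ (2 + Suc i * 2)"
      by (simp only: power_mult power_add)
    then have T: "\<Delta>\<^sup>2 / ?m * (\<Delta> ^ Suc i)\<^sup>2 = \<Delta> ^ (2 * Suc i + 2) / ?m"
      by (simp only: times_divide_eq_left) (simp add: mult.commute)
    have Y: "b\<^sup>2 * (b ^ (2 * i) * \<Delta>) = b ^ (2 * Suc i) * \<Delta>"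
      by (simp add: power2_eq_square)
    have "2 * T + 2 * (\<beta> * (c * (X + Y))) \<le> 2 * P + 2 * c * (P + Q)"
      if "T = P" "\<beta> * X \<le> P" "\<beta> * Y = Q" "0 \<le> c" for T \<beta> c X Y P Q :: real
    proof -
      have "c * (\<beta> * X + \<beta> * Y) \<le> c * (P + Q)"
        using that by (intro mult_left_mono) auto
      then show ?thesis using that(1) by (simp add: algebra_simps)
    qed
    from this[OF T X Y, of "4 ^ Suc i"] show ?thesis by (simp del: power_Suc mult_Suc_right)
  qed
  also have "\<dots> \<le> 4 ^ Suc (Suc i) * (\<Delta> ^ (2 * Suc i + 2) / ?m + b ^ (2 * Suc i) * \<Delta>)"
  proof -
    have X: "0 \<le> \<Delta> ^ (2 * Suc i + 2) / ?m" and Y: "0 \<le> b ^ (2 * Suc i) * \<Delta>"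
      using \<Delta>_nonneg b_nonneg by auto
    then show ?thesis
      using absorb_le(1)[OF X Y, of "4 ^ Suc i"] one_le_power[of "4::real" "Suc i"]
      by (simp only: power_Suc[of 4 "Suc i"])
  qed
  finally show ?case .
qed

text \<open>
  A closed walk of even length is cut into two halves, so their number is the square norm of a column
  of a power of B. For odd length the two halves are joined by an edge, and the bilinear bound
  applies.
\<close>

lemma closed_walks_le:
  assumes z: "z \<in> U" and a: "2 \<le> a" "a < 2 * k"
  shows "mpow U B a z z \<le> 4 ^ k * (\<Delta> ^ a / card U + b ^ (a - 2) * \<Delta>)"
proof -
  have sym: "mpow U B j z x = mpow U B j x z" if "x \<in> U" for j x
    by (rule mpow_sym[OF fin B_sym z that])
  show ?thesis
  proof (cases "even a")
  case True
  then obtain j where "a = 2 * j" by blast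
  with a have "a = Suc (j - 1) + Suc (j - 1)" "j - 1 < k" by auto
  then obtain i where i: "a = Suc i + Suc i" "i < k" by (rule that)
  have "mpow U B a z z = (\<Sum>x\<in>U. mpow U B (Suc i) z x * mpow U B (Suc i) x z)"
    unfolding i by (rule mpow_add[OF fin z])
  also have "\<dots> = (\<Sum>x\<in>U. (mpow U B (Suc i) x z)\<^sup>2)"
    by (intro sum.cong refl) (simp only: sym power2_eq_square)
  also have "\<dots> \<le> 4 ^ Suc i * (\<Delta> ^ (2 * i + 2) / card U + b ^ (2 * i) * \<Delta>)"
    by (rule sum_sq_mpow_col_le[OF z i(2)])
  also have "\<dots> \<le> 4 ^ k * (\<Delta> ^ (2 * i + 2) / card U + b ^ (2 * i) * \<Delta>)"
    using i \<Delta>_nonneg b_nonneg by (intro mult_right_mono power_increasing) auto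
  finally show ?thesis using i(1) by (simp add: mult_2)
next
  case False
  then obtain j where "a = Suc (2 * j)" by (auto elim: oddE)
  with a have "a = Suc (j - 1) + Suc (Suc (j - 1))" "Suc (j - 1) < k" by auto
  then obtain i where i: "a = Suc i + Suc (Suc i)" "Suc i < k" by (rule that)
  let ?f = "\<lambda>x. mpow U B (Suc i) x z"
  have "mpow U B a z z = (\<Sum>x\<in>U. mpow U B (Suc i) z x * mpow U B (Suc (Suc i)) x z)"
    unfolding i by (rule mpow_add[OF fin z])
  also have "\<dots> = (\<Sum>x\<in>U. ?f x * (\<Sum>y\<in>U. B x y * ?f y))"
    by (intro sum.cong refl) (simp only: sym mpow.simps(2)[of U B "Suc i"])
  also have "\<dots> = (\<Sum>x\<in>U. \<Sum>y\<in>U. ?f x * B x y * ?f y)"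
    by (simp add: sum_distrib_left mult.assoc)
  also have "\<dots> \<le> p * sum ?f U * sum ?f U + b * L2_set ?f U * L2_set ?f U"
    using small_form[OF small_mpow_col small_mpow_col, OF z _ z, of i i] i(2) by simp
  also have "b * L2_set ?f U * L2_set ?f U = b * (\<Sum>x\<in>U. (?f x)\<^sup>2)"
    by (simp add: L2_set_def sum_nonneg flip: power2_eq_square)
  also have "p * sum ?f U * sum ?f U + b * (\<Sum>x\<in>U. (?f x)\<^sup>2)
      \<le> (\<Delta> / card U) * \<Delta> ^ Suc i * \<Delta> ^ Suc i + b * (4 ^ Suc i * (\<Delta> ^ (2 * i + 2) / card U + b ^ (2 * i) * \<Delta>))"
  proof (intro add_mono mult_mono mult_left_mono sum_mpow_col_le z sum_sq_mpow_col_le)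
    show "p \<le> \<Delta> / card U" using p_le card_ge_1 by (simp add: field_simps)
  qed (use \<Delta>_nonneg b_nonneg p_nonneg i sum_mpow_col_nonneg in \<open>auto simp del: mpow.simps intro!: mult_nonneg_nonneg sum_nonneg\<close>)
  also have "\<dots> = \<Delta> ^ a / card U + 4 ^ Suc i * (b * \<Delta> ^ (2 * i + 2) / card U + b ^ (a - 2) * \<Delta>)"
  proof -
    have "\<Delta> * \<Delta> ^ Suc i * \<Delta> ^ Suc i = \<Delta> ^ a" unfolding i(1) by (simp add: power_add)
    then have "(\<Delta> / card U) * \<Delta> ^ Suc i * \<Delta> ^ Suc i = \<Delta> ^ a / card U" by simp
    moreover have "b * b ^ (2 * i) = b ^ (a - 2)" unfolding i(1) by (simp add: mult_2)
    then have "b * (b ^ (2 * i) * \<Delta>) = b ^ (a - 2) * \<Delta>" by (simp only: mult.assoc[symmetric])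
    then have "b * (4 ^ Suc i * (\<Delta> ^ (2 * i + 2) / card U + b ^ (2 * i) * \<Delta>))
        = 4 ^ Suc i * (b * \<Delta> ^ (2 * i + 2) / card U + b ^ (a - 2) * \<Delta>)"
      by (simp only: distrib_left mult.left_commute[of b "4 ^ Suc i"] times_divide_eq_right)
    ultimately show ?thesis by presburger
  qed
  also have "\<dots> \<le> \<Delta> ^ a / card U + 4 ^ Suc i * (\<Delta> ^ a / card U + b ^ (a - 2) * \<Delta>)"
  proof -
    have "b * \<Delta> ^ (2 * i + 2) \<le> \<Delta> * \<Delta> ^ (2 * i + 2)"
      using b_le \<Delta>_nonneg by (intro mult_right_mono) auto
    also have "\<dots> = \<Delta> ^ a" unfolding i by (simp add: mult_2)
    finally show ?thesis by (intro add_left_mono mult_left_mono add_right_mono divide_right_mono) auto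
  qed
  also have "\<dots> \<le> 4 ^ Suc (Suc i) * (\<Delta> ^ a / card U + b ^ (a - 2) * \<Delta>)"
  proof -
    have X: "0 \<le> \<Delta> ^ a / card U" and Y: "0 \<le> b ^ (a - 2) * \<Delta>"
      using \<Delta>_nonneg b_nonneg by auto
    then show ?thesis
      using absorb_le(2)[OF X Y, of "4 ^ Suc i"] one_le_power[of "4::real" "Suc i"]
      by (simp only: power_Suc[of 4 "Suc i"])
  qed
  also have "\<dots> \<le> 4 ^ k * (\<Delta> ^ a / card U + b ^ (a - 2) * \<Delta>)"
    using i \<Delta>_nonneg b_nonneg by (intro mult_right_mono power_increasing) auto
  finally show ?thesis .
qed
qed

text \<open>
  A bilinear form on a box attains its maximum at a vertex of the box. This bound therefore needs only
  the cut bound, and it applies to vectors of walk counts summed over all endpoints, which can exceed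
  the range allowed in the bilinear hypothesis.
\<close>

lemma form_le_of_bounded:
  assumes f: "\<And>x. x \<in> U \<Longrightarrow> 0 \<le> f x \<and> f x \<le> F" and g: "\<And>x. x \<in> U \<Longrightarrow> 0 \<le> g x \<and> g x \<le> G"
  shows "(\<Sum>x\<in>U. \<Sum>y\<in>U. f x * B x y * g y) \<le> p * sum f U * sum g U + F * G * b * card U"
proof -
  have F: "0 \<le> F" and G: "0 \<le> G" using f g ne by (meson ex_in_conv order_trans)+
  have cut: "sum (\<lambda>x. f x * h x) U \<le> F * sum h {x\<in>U. h x > 0}"
    if f: "\<And>x. x \<in> U \<Longrightarrow> 0 \<le> f x \<and> f x \<le> F" for f h :: "'a \<Rightarrow> real" and F
  proof -
    have "sum (\<lambda>x. f x * h x) U \<le> (\<Sum>x\<in>U. if h x > 0 then F * h x else 0)"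
      using f by (intro sum_mono) (auto intro!: mult_right_mono simp: mult_nonneg_nonpos not_less)
    also have "\<dots> = F * sum h {x\<in>U. h x > 0}"
      by (simp add: sum.If_cases fin sum_distrib_left Int_def)
    finally show ?thesis .
  qed
  define X where "X = {x\<in>U. (\<Sum>y\<in>U. (B x y - p) * g y) > 0}"
  define Y where "Y = {y\<in>U. (\<Sum>x\<in>X. B x y - p) > 0}"
  have XU: "X \<subseteq> U" and YU: "Y \<subseteq> U" by (auto simp: X_def Y_def)
  have "(\<Sum>x\<in>U. \<Sum>y\<in>U. f x * B x y * g y) - p * sum f U * sum g U
      = (\<Sum>x\<in>U. \<Sum>y\<in>U. f x * B x y * g y) - (\<Sum>x\<in>U. \<Sum>y\<in>U. p * (f x * g y))"
    unfolding mult.assoc[of p] sum_product unfolding sum_distrib_left ..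
  also have "\<dots> = (\<Sum>x\<in>U. f x * (\<Sum>y\<in>U. (B x y - p) * g y))"
    by (simp add: sum_subtractf sum_distrib_left algebra_simps)
  also have "\<dots> \<le> F * (\<Sum>x\<in>X. \<Sum>y\<in>U. (B x y - p) * g y)"
    unfolding X_def by (rule cut[OF f])
  also have "(\<Sum>x\<in>X. \<Sum>y\<in>U. (B x y - p) * g y) = (\<Sum>y\<in>U. g y * (\<Sum>x\<in>X. B x y - p))"
    by (subst sum.swap) (simp add: sum_distrib_left mult.commute)
  also have "F * \<dots> \<le> F * (G * (\<Sum>y\<in>Y. \<Sum>x\<in>X. B x y - p))"
    unfolding Y_def using F by (intro mult_left_mono cut[OF g]) auto
  also have "(\<Sum>y\<in>Y. \<Sum>x\<in>X. B x y - p) = (\<Sum>x\<in>U. \<Sum>y\<in>U. of_bool (x \<in> X) * (B x y - p) * of_bool (y \<in> Y))"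
  proof -
    have "(\<Sum>x\<in>U. \<Sum>y\<in>U. of_bool (x \<in> X) * (B x y - p) * of_bool (y \<in> Y))
        = (\<Sum>x\<in>X. \<Sum>y\<in>U. (B x y - p) * of_bool (y \<in> Y))"
      using XU fin by (intro sum.mono_neutral_cong_right) auto
    also have "\<dots> = (\<Sum>x\<in>X. \<Sum>y\<in>Y. B x y - p)"
      using YU fin by (intro sum.cong sum.mono_neutral_cong_right) auto
    finally show ?thesis by (simp add: sum.swap[of _ X Y])
  qed
  also have "F * (G * \<dots>) \<le> F * (G * (b * card U))"
  proof -
    have ind: "L2_set (\<lambda>x. of_bool (x \<in> X)) U \<le> sqrt (card U)" for X :: "'a set"
    proof -
      have "L2_set (\<lambda>x. of_bool (x \<in> X)) U \<le> L2_set (\<lambda>x. 1) U"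
        by (rule L2_set_mono) auto
      then show ?thesis by (simp add: L2_set_constant)
    qed
    have sm: "of_bool (x \<in> X) \<in> \<nat> \<and> of_bool (x \<in> X) \<le> real (card U) ^ (k - 1)" for x :: 'a and X
      using one_le_power[OF card_ge_1, of "k - 1"] by (auto simp: of_bool_def)
    have "(\<Sum>x\<in>U. \<Sum>y\<in>U. of_bool (x \<in> X) * (B x y - p) * of_bool (y \<in> Y))
        \<le> b * L2_set (\<lambda>x. of_bool (x \<in> X)) U * L2_set (\<lambda>x. of_bool (x \<in> Y)) U"
      using bilinear[of "\<lambda>x. of_bool (x \<in> X)" "\<lambda>y. of_bool (y \<in> Y)"] sm by fastforce
    also have "\<dots> \<le> b * sqrt (card U) * sqrt (card U)"
      using b_nonneg by (intro mult_mono ind mult_left_mono) auto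
    also have "\<dots> = b * card U" by simp
    finally show ?thesis using F G by (intro mult_left_mono)
  qed
  finally show ?thesis by (simp add: mult_ac)
qed

end

section \<open>Closed walks of odd length in a dense subgraph\<close>

text \<open>
  The heart of the proof. The form Q M N sums over closed walks of length 2j + 3 whose steps number
  j + 2 and 2j + 3 are weighted by M and N, and all other steps by A. It is nonnegative at M = N =
  B - A, and Q B A = Q A B because the walk can be rotated.
\<close>

lemma two_antipodal_edges:
  fixes A B :: "'a \<Rightarrow> 'a \<Rightarrow> real"
  assumes fin: "finite U" and A: "\<And>x y. x \<in> U \<Longrightarrow> y \<in> U \<Longrightarrow> 0 \<le> A x y \<and> A x y \<le> B x y"
  shows "2 * (\<Sum>v\<in>U. \<Sum>u\<in>U. mpow U A (2 * Suc j) v u * B u v)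
    \<le> (\<Sum>v\<in>U. \<Sum>x\<in>U. \<Sum>y\<in>U. mpow U A (Suc j) v x * B x y * (\<Sum>u\<in>U. mpow U A j y u * B u v))
      + (\<Sum>v\<in>U. mpow U A (2 * Suc j + 1) v v)"
proof -
  define Q where "Q M N = (\<Sum>v\<in>U. \<Sum>x\<in>U. \<Sum>y\<in>U. mpow U A (Suc j) v x * M x y * (\<Sum>u\<in>U. mpow U A j y u * N u v))"
    for M N :: "'a \<Rightarrow> 'a \<Rightarrow> real"
  \<comment> \<open>if M = A, all steps but the last one form a walk of length 2j + 2 in A\<close>
  have QA: "Q A N = (\<Sum>v\<in>U. \<Sum>u\<in>U. mpow U A (2 * Suc j) v u * N u v)" for N
  proof -
    have "(\<Sum>x\<in>U. \<Sum>y\<in>U. mpow U A (Suc j) v x * A x y * (\<Sum>u\<in>U. mpow U A j y u * N u v))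
        = (\<Sum>u\<in>U. mpow U A (2 * Suc j) v u * N u v)" if v: "v \<in> U" for v
    proof -
      have "(\<Sum>x\<in>U. \<Sum>y\<in>U. mpow U A (Suc j) v x * A x y * (\<Sum>u\<in>U. mpow U A j y u * N u v))
          = (\<Sum>x\<in>U. \<Sum>y\<in>U. \<Sum>u\<in>U. mpow U A (Suc j) v x * (A x y * mpow U A j y u) * N u v)"
        by (simp only: sum_distrib_left mult.assoc)
      also have "\<dots> = (\<Sum>x\<in>U. \<Sum>u\<in>U. \<Sum>y\<in>U. mpow U A (Suc j) v x * (A x y * mpow U A j y u) * N u v)"
        by (intro sum.cong refl sum.swap)
      also have "\<dots> = (\<Sum>u\<in>U. \<Sum>x\<in>U. \<Sum>y\<in>U. mpow U A (Suc j) v x * (A x y * mpow U A j y u) * N u v)"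
        by (rule sum.swap)
      also have "\<dots> = (\<Sum>u\<in>U. (\<Sum>x\<in>U. mpow U A (Suc j) v x * (\<Sum>y\<in>U. A x y * mpow U A j y u)) * N u v)"
        by (simp only: sum_distrib_left sum_distrib_right)
      also have "\<dots> = (\<Sum>u\<in>U. mpow U A (Suc j + Suc j) v u * N u v)"
        unfolding mpow_add[OF fin v] mpow.simps(2)[of U A j, symmetric] ..
      finally show ?thesis by (simp only: mult_2)
    qed
    then show ?thesis unfolding Q_def by (rule sum.cong[OF refl])
  qed
  have QAA: "Q A A = (\<Sum>v\<in>U. mpow U A (2 * Suc j + 1) v v)"
    unfolding QA using mpow_Suc_right[OF fin, of _ _ A "2 * Suc j"] by (intro sum.cong) auto
  \<comment> \<open>start the closed walk at the end of its step through M instead\<close>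
  have QBA: "Q B A = Q A B"
  proof -
    have "Q B A = (\<Sum>v\<in>U. \<Sum>x\<in>U. \<Sum>y\<in>U. \<Sum>u\<in>U. B x y * (mpow U A j y u * (A u v * mpow U A (Suc j) v x)))"
      unfolding Q_def sum_distrib_left by (intro sum.cong refl) (simp only: mult_ac)
    also have "\<dots> = (\<Sum>y\<in>U. \<Sum>x\<in>U. \<Sum>u\<in>U. \<Sum>v\<in>U. B x y * (mpow U A j y u * (A u v * mpow U A (Suc j) v x)))"
      unfolding sum.cartesian_product
      by (rule sum.reindex_bij_witness[where i = "\<lambda>(y,x,u,v). (v,x,y,u)" and j = "\<lambda>(v,x,y,u). (y,x,u,v)"]) auto
    also have "\<dots> = (\<Sum>y\<in>U. \<Sum>x\<in>U. mpow U A (j + Suc (Suc j)) y x * B x y)"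
    proof (intro sum.cong refl)
      fix x y assume "y \<in> U"
      then show "(\<Sum>u\<in>U. \<Sum>v\<in>U. B x y * (mpow U A j y u * (A u v * mpow U A (Suc j) v x)))
          = mpow U A (j + Suc (Suc j)) y x * B x y"
        unfolding mpow_add[OF fin \<open>y \<in> U\<close>] mpow.simps(2)[of U A "Suc j"] sum_distrib_right sum_distrib_left
        by (intro sum.cong refl) (simp only: mult_ac)
    qed
    finally show ?thesis unfolding QA by (simp add: mult_2)
  qed
  have "0 \<le> Q (\<lambda>x y. B x y - A x y) (\<lambda>x y. B x y - A x y)"
    unfolding Q_def
    by (intro sum_nonneg mult_nonneg_nonneg mpow_nonneg) (use A in auto)
  also have "\<dots> = Q B B - Q B A - Q A B + Q A A"
    unfolding Q_def by (simp add: sum_subtractf left_diff_distrib right_diff_distrib del: mpow.simps)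
  finally show ?thesis using QBA QA[of B] QAA unfolding Q_def by linarith
qed

locale pseudorandom_pair = pseudorandom_matrix +
  fixes A :: "'a \<Rightarrow> 'a \<Rightarrow> real" and s :: real
  assumes A_sym: "\<And>x y. x \<in> U \<Longrightarrow> y \<in> U \<Longrightarrow> A x y = A y x"
    and A_01: "\<And>x y. x \<in> U \<Longrightarrow> y \<in> U \<Longrightarrow> A x y \<in> {0, 1}"
    and A_le: "\<And>x y. x \<in> U \<Longrightarrow> y \<in> U \<Longrightarrow> A x y \<le> B x y"
    and s_nonneg: "0 \<le> s" and min_deg: "\<And>x. x \<in> U \<Longrightarrow> s \<le> (\<Sum>y\<in>U. A x y)"
begin

definition walks :: "nat \<Rightarrow> 'a \<Rightarrow> real" where
  "walks i x = (\<Sum>y\<in>U. mpow U A i x y)"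

lemma A_bounds: "x \<in> U \<Longrightarrow> y \<in> U \<Longrightarrow> 0 \<le> A x y \<and> A x y \<le> 1"
  using A_01[of x y] by auto

lemma mpow_A_sym: "x \<in> U \<Longrightarrow> y \<in> U \<Longrightarrow> mpow U A i x y = mpow U A i y x"
  by (rule mpow_sym[OF fin A_sym])

lemma mpow_A_nonneg: "x \<in> U \<Longrightarrow> 0 \<le> mpow U A i x y"
  using A_bounds by (intro mpow_nonneg) auto

lemma mpow_A_le: "x \<in> U \<Longrightarrow> mpow U A i x y \<le> mpow U B i x y"
  using A_bounds A_le by (intro mpow_mono) auto

lemma walks_nonneg: "x \<in> U \<Longrightarrow> 0 \<le> walks i x"
  unfolding walks_def by (intro sum_nonneg mpow_A_nonneg)

lemma walks_le:
  assumes "x \<in> U"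
  shows "walks i x \<le> \<Delta> ^ i"
proof -
  have "walks i x \<le> (\<Sum>y\<in>U. mpow U B i x y)"
    unfolding walks_def using assms by (intro sum_mono mpow_A_le)
  also have "\<dots> \<le> \<Delta> ^ i"
    using B_bounds deg fin assms by (intro mpow_row_sum_le) auto
  finally show ?thesis .
qed

lemma walks_0: "x \<in> U \<Longrightarrow> walks 0 x = 1"
proof -
  assume "x \<in> U"
  then have "(\<Sum>y\<in>U. of_bool (x = y)) = (\<Sum>y\<in>{x}. 1::real)"
    using fin by (intro sum.mono_neutral_cong_right) auto
  then show ?thesis by (simp add: walks_def)
qed

lemma sum_walks_Suc: "s * sum (walks i) U \<le> sum (walks (Suc i)) U"
proof -
  have "sum (walks (Suc i)) U = (\<Sum>x\<in>U. \<Sum>y\<in>U. \<Sum>z\<in>U. mpow U A i x z * A z y)"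
    unfolding walks_def by (intro sum.cong refl mpow_Suc_right fin)
  also have "\<dots> = (\<Sum>x\<in>U. \<Sum>z\<in>U. mpow U A i x z * (\<Sum>y\<in>U. A z y))"
    unfolding sum_distrib_left by (intro sum.cong refl sum.swap)
  also have "\<dots> \<ge> (\<Sum>x\<in>U. \<Sum>z\<in>U. mpow U A i x z * s)"
    by (intro sum_mono mult_left_mono min_deg mpow_A_nonneg)
  finally show ?thesis by (simp add: walks_def sum_distrib_left mult.commute)
qed

lemma sum_walks_ge: "s ^ i * card U \<le> sum (walks i) U"
proof (induction i)
  case 0
  show ?case using walks_0 by simp
next
  case (Suc i)
  have "s ^ Suc i * card U = s * (s ^ i * card U)" by simp
  also have "\<dots> \<le> s * sum (walks i) U" using Suc s_nonneg by (intro mult_left_mono)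
  also have "\<dots> \<le> sum (walks (Suc i)) U" by (rule sum_walks_Suc)
  finally show ?case .
qed

lemma small_dominated:
  assumes "\<And>x. x \<in> U \<Longrightarrow> f x \<in> \<nat>" "\<And>x. x \<in> U \<Longrightarrow> f x \<le> g x" "small g"
  shows "small f"
  using assms unfolding small_def by (meson order_trans)

lemma mpow_A_Nats: "x \<in> U \<Longrightarrow> mpow U A i x z \<in> \<nat>"
  by (rule mpow_in_Nats) (use A_01 in fastforce)+

lemma L2_set_mult_le_of_dominated:
  assumes "\<And>x. x \<in> U \<Longrightarrow> 0 \<le> f x \<and> f x \<le> h x" "\<And>x. x \<in> U \<Longrightarrow> 0 \<le> g x \<and> g x \<le> h x"
  shows "b * L2_set f U * L2_set g U \<le> b * (\<Sum>x\<in>U. (h x)\<^sup>2)"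
proof -
  have "L2_set f U * L2_set g U \<le> L2_set h U * L2_set h U"
    using assms by (intro mult_mono L2_set_mono) auto
  also have "\<dots> = (\<Sum>x\<in>U. (h x)\<^sup>2)"
    by (simp add: L2_set_def sum_nonneg)
  finally show ?thesis using b_nonneg by (simp add: mult.assoc mult_left_mono)
qed

text \<open>
  The walk of length 2k is cut at its midpoint z. Its two ends are then joined by an edge of B, which
  is the bilinear form of B at the vector of walk counts from z.
\<close>

lemma closed_walks_lower:
  assumes k: "k = Suc j"
  shows "p * (\<Sum>z\<in>U. (walks k z)\<^sup>2) - b * (\<Sum>z\<in>U. \<Sum>x\<in>U. (mpow U B k x z)\<^sup>2)
    \<le> (\<Sum>v\<in>U. \<Sum>u\<in>U. mpow U A (2 * k) v u * B u v)"
proof -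
  have "(\<Sum>v\<in>U. \<Sum>u\<in>U. mpow U A (2 * k) v u * B u v)
      = (\<Sum>v\<in>U. \<Sum>u\<in>U. \<Sum>z\<in>U. mpow U A k u z * B u v * mpow U A k v z)"
  proof (intro sum.cong refl)
    fix v u assume "v \<in> U" "u \<in> U"
    then have e: "mpow U A (2 * k) v u = (\<Sum>z\<in>U. mpow U A k v z * mpow U A k u z)"
      unfolding mult_2 mpow_add[OF fin \<open>v \<in> U\<close>] by (intro sum.cong refl) (simp only: mpow_A_sym)
    show "mpow U A (2 * k) v u * B u v = (\<Sum>z\<in>U. mpow U A k u z * B u v * mpow U A k v z)"
      unfolding e sum_distrib_right by (simp only: mult_ac)
  qed
  also have "\<dots> = (\<Sum>z\<in>U. \<Sum>u\<in>U. \<Sum>v\<in>U. mpow U A k u z * B u v * mpow U A k v z)"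
    unfolding sum.cartesian_product
    by (rule sum.reindex_bij_witness[where i = "\<lambda>(z,u,v). (v,u,z)" and j = "\<lambda>(v,u,z). (z,u,v)"]) auto
  also have "\<dots> \<ge> (\<Sum>z\<in>U. p * (walks k z)\<^sup>2 - b * (\<Sum>x\<in>U. (mpow U B k x z)\<^sup>2))"
  proof (rule sum_mono)
    fix z assume z: "z \<in> U"
    let ?f = "\<lambda>x. mpow U A k x z"
    have "small (\<lambda>x. mpow U B k x z)" using small_mpow_col[OF z, of j] unfolding k by blast
    with mpow_A_Nats mpow_A_le have sm: "small ?f" by (rule small_dominated)
    have w: "sum ?f U = walks k z"
      unfolding walks_def using z by (intro sum.cong refl mpow_A_sym)
    have "b * L2_set ?f U * L2_set ?f U \<le> b * (\<Sum>x\<in>U. (mpow U B k x z)\<^sup>2)"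
      by (rule L2_set_mult_le_of_dominated) (simp_all add: mpow_A_nonneg mpow_A_le del: mpow.simps)
    with small_form[OF sm sm]
    show "p * (walks k z)\<^sup>2 - b * (\<Sum>x\<in>U. (mpow U B k x z)\<^sup>2)
        \<le> (\<Sum>u\<in>U. \<Sum>v\<in>U. mpow U A k u z * B u v * mpow U A k v z)"
      unfolding w by (simp add: power2_eq_square del: mpow.simps)
  qed
  finally show ?thesis by (simp add: sum_subtractf sum_distrib_left)
qed

text \<open>
  Both edges of B are replaced by p in turn: the one opposite to v by the bilinear bound at the two
  spread-out vectors of walks from v, and the one at v, after summing over the far endpoints, by the
  bound for bounded vectors.
\<close>

lemma closed_walks_upper:
  assumes k: "k = Suc j"
  shows "(\<Sum>v\<in>U. \<Sum>x\<in>U. \<Sum>y\<in>U. mpow U A k v x * B x y * (\<Sum>u\<in>U. mpow U A j y u * B u v))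
    \<le> p * (p * sum (walks k) U * sum (walks j) U + \<Delta> ^ k * \<Delta> ^ j * b * card U)
      + b * (\<Sum>z\<in>U. \<Sum>x\<in>U. (mpow U B k x z)\<^sup>2)"
proof -
  define g where "g v y = (\<Sum>u\<in>U. mpow U A j y u * B u v)" for v y
  have g_nonneg: "0 \<le> g v y" if "v \<in> U" "y \<in> U" for v y
    unfolding g_def using that B_bounds mpow_A_nonneg by (intro sum_nonneg mult_nonneg_nonneg) auto
  have g_le: "g v y \<le> mpow U B k y v" if "v \<in> U" "y \<in> U" for v y
    unfolding g_def k mpow_Suc_right[OF fin that(2,1)]
    using that B_bounds mpow_A_le by (intro sum_mono mult_right_mono) auto
  have g_Nats: "g v y \<in> \<nat>" if "v \<in> U" "y \<in> U" for v y
    unfolding g_def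
  proof (rule sum_in_Nats)
    fix u assume u: "u \<in> U"
    have "B u v \<in> \<nat>" using B_01[OF u that(1)] by auto
    then show "mpow U A j y u * B u v \<in> \<nat>"
      using mpow_A_Nats[OF that(2), of j u] by (rule Nats_mult[rotated])
  qed
  have sum_g: "sum (g v) U = (\<Sum>u\<in>U. B v u * walks j u)" if v: "v \<in> U" for v
  proof -
    have "sum (g v) U = (\<Sum>u\<in>U. \<Sum>y\<in>U. mpow U A j y u * B u v)"
      unfolding g_def by (rule sum.swap)
    also have "\<dots> = (\<Sum>u\<in>U. B v u * walks j u)"
    proof (intro sum.cong refl)
      fix u assume u: "u \<in> U"
      show "(\<Sum>y\<in>U. mpow U A j y u * B u v) = B v u * walks j u"
        unfolding walks_def sum_distrib_left
        by (intro sum.cong refl) (simp only: mpow_A_sym[OF _ u] B_sym[OF v u] mult.commute)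
    qed
    finally show ?thesis .
  qed
  have "(\<Sum>v\<in>U. \<Sum>x\<in>U. \<Sum>y\<in>U. mpow U A k v x * B x y * g v y)
      \<le> (\<Sum>v\<in>U. p * (walks k v * sum (g v) U) + b * (\<Sum>x\<in>U. (mpow U B k x v)\<^sup>2))"
  proof (rule sum_mono)
    fix v assume v: "v \<in> U"
    have smB: "small (\<lambda>x. mpow U B k x v)" using small_mpow_col[OF v, of j] unfolding k by blast
    have A_le_B: "mpow U A k v x \<le> mpow U B k x v" if "x \<in> U" for x
      unfolding mpow_A_sym[OF v that] by (rule mpow_A_le[OF that])
    have smf: "small (mpow U A k v)"
      using mpow_A_Nats[OF v] A_le_B smB by (rule small_dominated)
    have smg: "small (g v)"
      using g_Nats[OF v] g_le[OF v] smB by (rule small_dominated)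
    have "b * L2_set (mpow U A k v) U * L2_set (g v) U \<le> b * (\<Sum>x\<in>U. (mpow U B k x v)\<^sup>2)"
    proof (rule L2_set_mult_le_of_dominated)
      show "0 \<le> mpow U A k v x \<and> mpow U A k v x \<le> mpow U B k x v" if "x \<in> U" for x
        using mpow_A_nonneg[OF v] A_le_B[OF that] by blast
      show "0 \<le> g v y \<and> g v y \<le> mpow U B k y v" if "y \<in> U" for y
        using g_nonneg[OF v that] g_le[OF v that] by blast
    qed
    with small_form[OF smf smg]
    show "(\<Sum>x\<in>U. \<Sum>y\<in>U. mpow U A k v x * B x y * g v y)
        \<le> p * (walks k v * sum (g v) U) + b * (\<Sum>x\<in>U. (mpow U B k x v)\<^sup>2)"
      unfolding walks_def by (simp add: mult.assoc del: mpow.simps)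
  qed
  also have "\<dots> = p * (\<Sum>v\<in>U. \<Sum>u\<in>U. walks k v * B v u * walks j u) + b * (\<Sum>z\<in>U. \<Sum>x\<in>U. (mpow U B k x z)\<^sup>2)"
  proof -
    have "(\<Sum>v\<in>U. p * (walks k v * sum (g v) U)) = p * (\<Sum>v\<in>U. \<Sum>u\<in>U. walks k v * B v u * walks j u)"
      unfolding sum_distrib_left[of p]
      by (intro sum.cong refl) (simp only: sum_g sum_distrib_left mult.assoc)
    then show ?thesis by (simp only: sum.distrib sum_distrib_left[of b])
  qed
  also have "\<dots> \<le> p * (p * sum (walks k) U * sum (walks j) U + \<Delta> ^ k * \<Delta> ^ j * b * card U)
      + b * (\<Sum>z\<in>U. \<Sum>x\<in>U. (mpow U B k x z)\<^sup>2)"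
    by (intro add_right_mono mult_left_mono form_le_of_bounded p_nonneg conjI walks_nonneg walks_le)
  finally show ?thesis unfolding g_def .
qed

text \<open>
  The main term. Its left-hand side comes from p W_k (2 W_k - p m W_(k-1)) / m by inserting the
  bounds for the walk counts W_i that follow from the minimum degree s.
\<close>

lemma closed_odd_walks_lower:
  "p / card U * s ^ (2 * k - 1) * (2 * s - p * card U) * (real (card U))\<^sup>2
     \<le> (\<Sum>z\<in>U. mpow U A (2 * k + 1) z z) + p * b * card U * \<Delta> ^ (2 * k - 1)
       + 3 * b * (4 ^ k * (\<Delta> ^ (2 * k) + card U * b ^ (2 * k - 2) * \<Delta>))"
  if sp: "p * card U \<le> 2 * s"
proof -
  obtain j where k: "k = Suc j" using k_pos by (cases k) auto
  let ?m = "real (card U)"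
  let ?W = "\<lambda>i. sum (walks i) U"
  define q where "q = (\<Sum>z\<in>U. \<Sum>x\<in>U. (mpow U B k x z)\<^sup>2)"
  have q_le: "q \<le> 4 ^ k * (\<Delta> ^ (2 * k) + ?m * b ^ (2 * k - 2) * \<Delta>)"
  proof -
    have "q \<le> (\<Sum>z\<in>U. 4 ^ k * (\<Delta> ^ (2 * k) / ?m + b ^ (2 * k - 2) * \<Delta>))"
      unfolding q_def using sum_sq_mpow_col_le[of _ j] k by (intro sum_mono) simp
    also have "\<dots> = 4 ^ k * (\<Delta> ^ (2 * k) + ?m * b ^ (2 * k - 2) * \<Delta>)"
      using card_ge_1 by (simp add: field_simps)
    finally show ?thesis .
  qed
  have W_nonneg: "0 \<le> ?W i" for i by (intro sum_nonneg walks_nonneg)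
  have cs: "(?W k)\<^sup>2 \<le> ?m * (\<Sum>z\<in>U. (walks k z)\<^sup>2)"
  proof -
    have "?W k = (\<Sum>z\<in>U. \<bar>1\<bar> * \<bar>walks k z\<bar>)"
      using walks_nonneg by (intro sum.cong) auto
    also have "\<dots> \<le> L2_set (\<lambda>_. 1) U * L2_set (walks k) U" by (rule L2_set_mult_ineq)
    finally have "(?W k)\<^sup>2 \<le> (L2_set (\<lambda>_. 1) U * L2_set (walks k) U)\<^sup>2"
      by (intro power_mono W_nonneg)
    then show ?thesis by (simp add: L2_set_def power_mult_distrib sum_nonneg)
  qed
  have "2 * (p * ((?W k)\<^sup>2 / ?m) - b * q) \<le> 2 * (p * (\<Sum>z\<in>U. (walks k z)\<^sup>2) - b * q)"
    using cs card_ge_1 p_nonneg by (intro mult_left_mono diff_right_mono) (auto simp: divide_le_eq mult.commute)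
  also have "\<dots> \<le> 2 * (\<Sum>v\<in>U. \<Sum>u\<in>U. mpow U A (2 * k) v u * B u v)"
    using closed_walks_lower[OF k] unfolding q_def by simp
  also have "\<dots> \<le> (\<Sum>v\<in>U. \<Sum>x\<in>U. \<Sum>y\<in>U. mpow U A k v x * B x y * (\<Sum>u\<in>U. mpow U A j y u * B u v))
      + (\<Sum>v\<in>U. mpow U A (2 * k + 1) v v)"
    unfolding k using A_bounds A_le by (intro two_antipodal_edges fin) auto
  also have "\<dots> \<le> p * (p * ?W k * ?W j + \<Delta> ^ k * \<Delta> ^ j * b * ?m) + b * q + (\<Sum>v\<in>U. mpow U A (2 * k + 1) v v)"
    using closed_walks_upper[OF k] unfolding q_def by simp
  also have "\<Delta> ^ k * \<Delta> ^ j = \<Delta> ^ (2 * k - 1)"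
    unfolding k by (simp flip: power_add add: mult_2)
  finally have main: "p / ?m * ?W k * (2 * ?W k - p * ?m * ?W j)
      \<le> (\<Sum>v\<in>U. mpow U A (2 * k + 1) v v) + p * b * ?m * \<Delta> ^ (2 * k - 1) + 3 * b * q"
    using card_ge_1 by (simp add: field_simps power2_eq_square)
  have "p / ?m * s ^ (2 * k - 1) * (2 * s - p * ?m) * ?m\<^sup>2
      = p / ?m * (s ^ k * ?m) * ((2 * s - p * ?m) * (s ^ j * ?m))"
  proof -
    have "s ^ (2 * k - 1) = s ^ k * s ^ j" unfolding k by (simp flip: power_add add: mult_2)
    then show ?thesis by (simp only: power2_eq_square mult_ac)
  qed
  also have "\<dots> \<le> p / ?m * ?W k * ((2 * s - p * ?m) * ?W j)"
    using sp p_nonneg s_nonneg W_nonneg sum_walks_ge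
    by (intro mult_mono mult_left_mono) (auto intro!: mult_nonneg_nonneg)
  also have "\<dots> \<le> p / ?m * ?W k * (2 * ?W k - p * ?m * ?W j)"
    using sum_walks_Suc[of j] p_nonneg W_nonneg unfolding k[symmetric]
    by (intro mult_left_mono) (auto simp: algebra_simps)
  also note main
  also have "3 * b * q \<le> 3 * b * (4 ^ k * (\<Delta> ^ (2 * k) + ?m * b ^ (2 * k - 2) * \<Delta>))"
    using q_le b_nonneg by (intro mult_left_mono) auto
  finally show ?thesis by simp
qed

end

context pseudorandom_pair
begin

text \<open>
  The product of the two bounds for closed walks has four terms. As b is at most \<Delta>, the mixed ones
  are at most \<Delta>^(2k).
\<close>

lemma sum_closed_walk_products_le:
  assumes ac: "2 \<le> a" "2 \<le> c" "a + c = 2 * k + 1"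
  shows "(\<Sum>z\<in>U. mpow U A a z z * mpow U A c z z)
    \<le> 16 ^ k * (\<Delta> ^ (2 * k + 1) / card U + 2 * \<Delta> ^ (2 * k) + card U * b ^ (2 * k - 3) * \<Delta>\<^sup>2)"
proof -
  let ?m = "real (card U)"
  have *: "mpow U A i z z \<le> 4 ^ k * (\<Delta> ^ i / ?m + b ^ (i - 2) * \<Delta>)" if "z \<in> U" "2 \<le> i" "i < 2 * k" for i z
    using closed_walks_le[OF that] mpow_A_le[OF that(1)] by (rule order_trans[rotated])
  have X: "0 \<le> \<Delta> ^ i / ?m + b ^ (i - 2) * \<Delta>" for i
    using \<Delta>_nonneg b_nonneg by auto
  have "(\<Sum>z\<in>U. mpow U A a z z * mpow U A c z z)
      \<le> (\<Sum>z\<in>U. (4 ^ k * (\<Delta> ^ a / ?m + b ^ (a - 2) * \<Delta>)) * (4 ^ k * (\<Delta> ^ c / ?m + b ^ (c - 2) * \<Delta>)))"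
    using ac X by (intro sum_mono mult_mono * mpow_A_nonneg mult_nonneg_nonneg[OF _ X]) auto
  also have "\<dots> = 16 ^ k * (?m * ((\<Delta> ^ a / ?m + b ^ (a - 2) * \<Delta>) * (\<Delta> ^ c / ?m + b ^ (c - 2) * \<Delta>)))"
  proof -
    have e: "(16::real) ^ k = 4 ^ k * 4 ^ k" by (simp flip: power_mult_distrib)
    show ?thesis unfolding e by (simp add: mult_ac)
  qed
  also have "?m * ((\<Delta> ^ a / ?m + b ^ (a - 2) * \<Delta>) * (\<Delta> ^ c / ?m + b ^ (c - 2) * \<Delta>))
      = \<Delta> ^ a * \<Delta> ^ c / ?m + \<Delta> ^ a * \<Delta> * b ^ (c - 2) + \<Delta> ^ c * \<Delta> * b ^ (a - 2) + ?m * (b ^ (a - 2) * b ^ (c - 2)) * \<Delta>\<^sup>2"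
    using card_ge_1 by (simp add: field_simps power2_eq_square)
  also have "\<dots> \<le> \<Delta> ^ (2 * k + 1) / ?m + \<Delta> ^ (2 * k) + \<Delta> ^ (2 * k) + ?m * b ^ (2 * k - 3) * \<Delta>\<^sup>2"
  proof (intro add_mono)
    show "\<Delta> ^ a * \<Delta> ^ c / ?m \<le> \<Delta> ^ (2 * k + 1) / ?m" using ac(3) by (simp flip: power_add)
    have "\<Delta> ^ i * \<Delta> * b ^ (j - 2) \<le> \<Delta> ^ (2 * k)" if "2 \<le> j" "i + j = 2 * k + 1" for i j
    proof -
      have "\<Delta> ^ i * \<Delta> * b ^ (j - 2) \<le> \<Delta> ^ i * \<Delta> * \<Delta> ^ (j - 2)"
        using \<Delta>_nonneg b_nonneg b_le by (intro mult_left_mono power_mono) auto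
      also have "\<dots> = \<Delta> ^ (Suc i + (j - 2))" by (simp add: power_add)
      also have "Suc i + (j - 2) = 2 * k" using that by auto
      finally show ?thesis .
    qed
    from this[OF ac(2,3)] this[OF ac(1), of c] ac(3)
    show "\<Delta> ^ a * \<Delta> * b ^ (c - 2) \<le> \<Delta> ^ (2 * k)" "\<Delta> ^ c * \<Delta> * b ^ (a - 2) \<le> \<Delta> ^ (2 * k)" by simp_all
    have "b ^ (a - 2) * b ^ (c - 2) = b ^ (2 * k - 3)"
    proof -
      have "(a - 2) + (c - 2) = 2 * k - 3" using ac by linarith
      then show ?thesis by (simp flip: power_add)
    qed
    then show "?m * (b ^ (a - 2) * b ^ (c - 2)) * \<Delta>\<^sup>2 \<le> ?m * b ^ (2 * k - 3) * \<Delta>\<^sup>2" by simp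
  qed
  finally show ?thesis by (simp add: add_ac)
qed

text \<open>
  For k = 1 there is nothing to count, since 3 is not a sum of two lengths that are at least 2. The
  general bound would be too weak there: 2k - 3 is truncated to 0, so its last summand is of order
  m \<Delta>^2.
\<close>

lemma closed_odd_walks_upper:
  assumes A_eq: "A = (\<lambda>x y. of_bool (R x y))" and irrefl: "\<And>x. x \<in> U \<Longrightarrow> \<not> R x x"
    and no_cycle: "\<And>x xs. xs \<in> walk_lists U R (2 * k + 1) x x \<Longrightarrow> \<not> distinct (take (2 * k + 1) xs)"
  shows "(\<Sum>z\<in>U. mpow U A (2 * k + 1) z z) \<le> (if k = 1 then 0 else
    real ((2 * k + 1)\<^sup>2) * (16 ^ k * (\<Delta> ^ (2 * k + 1) / card U + 2 * \<Delta> ^ (2 * k) + card U * b ^ (2 * k - 3) * \<Delta>\<^sup>2)))"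
proof -
  define I where "I = {(i, j). i + 2 \<le> j \<and> j < 2 * k + 1 \<and> j - i + 2 \<le> 2 * k + 1}"
  define Z where "Z = 16 ^ k * (\<Delta> ^ (2 * k + 1) / card U + 2 * \<Delta> ^ (2 * k) + card U * b ^ (2 * k - 3) * \<Delta>\<^sup>2)"
  have Z: "0 \<le> Z" unfolding Z_def using \<Delta>_nonneg b_nonneg by (intro mult_nonneg_nonneg add_nonneg_nonneg) auto
  have "(\<Sum>z\<in>U. mpow U A (2 * k + 1) z z)
      \<le> (\<Sum>(i, j)\<in>I. \<Sum>z\<in>U. mpow U A (j - i) z z * mpow U A (2 * k + 1 - (j - i)) z z)"
    unfolding I_def A_eq using irrefl no_cycle by (rule closed_walks_le_sum_degenerate[OF fin])
  also have "\<dots> \<le> (\<Sum>(i, j)\<in>I. Z)"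
  proof (rule sum_mono, unfold case_prod_unfold)
    fix t assume t: "t \<in> I"
    show "(\<Sum>z\<in>U. mpow U A (snd t - fst t) z z * mpow U A (2 * k + 1 - (snd t - fst t)) z z) \<le> Z"
      unfolding Z_def by (rule sum_closed_walk_products_le) (use t in \<open>auto simp: I_def\<close>)
  qed
  also have "\<dots> = real (card I) * Z" by simp
  also have "\<dots> \<le> (if k = 1 then 0 else real ((2 * k + 1)\<^sup>2) * Z)"
  proof (cases "k = 1")
    case True
    then have "I = {}" unfolding I_def by auto
    with True show ?thesis by simp
  next
    case False
    have "card I \<le> card ({..<2 * k + 1} \<times> {..<2 * k + 1})"
      by (rule card_mono) (auto simp: I_def)
    then have "real (card I) \<le> real ((2 * k + 1)\<^sup>2)" by (simp only: of_nat_le_iff) (simp add: power2_eq_square)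
    with False Z show ?thesis by (simp only: if_False) (intro mult_right_mono)
  qed
  finally show ?thesis unfolding Z_def .
qed

end

text \<open>
  The total of the coefficients of all error terms, each of which is measured in units of
  \<eta> d^(2k+1) under the assumption that degrees are at most K d.
\<close>

definition error_const :: "nat \<Rightarrow> real \<Rightarrow> real" where
  "error_const k K = real ((2 * k + 1)\<^sup>2) * 16 ^ k * (K ^ (2 * k + 1) + 2 * K ^ (2 * k) + K\<^sup>2)
     + K ^ (2 * k - 1) + 3 * 4 ^ k * (K ^ (2 * k) + K)"

lemma error_const_pos: "1 \<le> K \<Longrightarrow> 0 < error_const k K"
  unfolding error_const_def by (intro add_nonneg_pos add_nonneg_nonneg mult_nonneg_nonneg mult_pos_pos add_pos_pos) auto

context pseudorandom_pair
begin

text \<open>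
  Lower and upper bounds for the closed walks of length 2k+1 contradict each other if there is no
  cycle. With d = p m, the main term is at least \<delta> d^(2k+1) / 4^k, and each error term is at most a
  constant times \<eta> d^(2k+1).
\<close>

theorem exists_odd_cycle:
  fixes d K \<delta> \<eta> :: real
  assumes A_eq: "A = (\<lambda>x y. of_bool (R x y))" and irrefl: "\<And>x. x \<in> U \<Longrightarrow> \<not> R x x"
    and d: "d = p * card U" and d_pos: "0 < d" and K: "\<Delta> \<le> K * d" "1 \<le> K"
    and \<delta>: "0 < \<delta>" and s: "(1 + \<delta>) * d \<le> 2 * s"
    and \<eta>: "0 < \<eta>" "4 ^ k * error_const k K * \<eta> < \<delta>"
    and b: "b \<le> \<eta> * d" "card U * b ^ (2 * k - 1) \<le> \<eta> * d ^ (2 * k)"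
    and large: "1 \<le> \<eta> * d" "1 \<le> \<eta> * card U"
    and b': "2 \<le> k \<Longrightarrow> card U * b ^ (2 * k - 3) \<le> \<eta> * d ^ (2 * k - 1)"
  shows "\<exists>x xs. xs \<in> walk_lists U R (2 * k + 1) x x \<and> distinct (take (2 * k + 1) xs)"
proof (rule ccontr)
  assume "\<not> ?thesis"
  then have no: "\<not> distinct (take (2 * k + 1) xs)" if "xs \<in> walk_lists U R (2 * k + 1) x x" for x xs
    using that by blast
  let ?m = "real (card U)"
  define D where "D = d ^ (2 * k + 1)"
  have D_pos: "0 < D" unfolding D_def using d_pos by simp
  have \<Delta>pow: "\<Delta> ^ i \<le> K ^ i * d ^ i" for i
    using power_mono[OF K(1) \<Delta>_nonneg, of i] by (simp add: power_mult_distrib)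
  have K0: "0 \<le> K" using K by simp
  have D1: "d ^ (2 * k) * d = D" "d * d ^ (2 * k) = D" unfolding D_def by simp_all
  have D2: "d * d ^ (2 * k - 1) * d = D"
  proof -
    have "d * d ^ (2 * k - 1) = d ^ (Suc (2 * k - 1))" by simp
    also have "Suc (2 * k - 1) = 2 * k" using k_pos by auto
    finally show ?thesis using D1 by simp
  qed
  have t1: "\<Delta> ^ (2 * k + 1) / ?m \<le> K ^ (2 * k + 1) * (\<eta> * D)"
  proof -
    have "\<Delta> ^ (2 * k + 1) / ?m \<le> (K ^ (2 * k + 1) * D) * (1 / ?m)"
      using \<Delta>pow[of "2 * k + 1"] card_ge_1 unfolding D_def by (simp add: divide_right_mono)
    also have "\<dots> \<le> (K ^ (2 * k + 1) * D) * \<eta>"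
      using large(2) card_ge_1 K0 D_pos by (intro mult_left_mono) (auto simp: divide_le_eq)
    finally show ?thesis by (simp only: mult_ac)
  qed
  have t2: "\<Delta> ^ (2 * k) \<le> K ^ (2 * k) * (\<eta> * D)"
  proof -
    have "\<Delta> ^ (2 * k) \<le> K ^ (2 * k) * d ^ (2 * k) * 1" using \<Delta>pow[of "2 * k"] by simp
    also have "\<dots> \<le> K ^ (2 * k) * d ^ (2 * k) * (\<eta> * d)"
      using large(1) K0 d_pos by (intro mult_left_mono) auto
    also have "\<dots> = K ^ (2 * k) * (\<eta> * (d ^ (2 * k) * d))" by (simp only: mult_ac)
    finally show ?thesis unfolding D1 .
  qed
  have t3: "?m * b ^ (2 * k - 3) * \<Delta>\<^sup>2 \<le> K\<^sup>2 * (\<eta> * D)" if k2: "2 \<le> k"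
  proof -
    have "?m * b ^ (2 * k - 3) * \<Delta>\<^sup>2 \<le> (\<eta> * d ^ (2 * k - 1)) * (K\<^sup>2 * d\<^sup>2)"
      using \<eta>(1) d_pos by (intro mult_mono[OF b'[OF k2] \<Delta>pow]) auto
    also have "\<dots> = K\<^sup>2 * (\<eta> * (d * d ^ (2 * k - 1) * d))" by (simp only: power2_eq_square mult_ac)
    finally show ?thesis unfolding D2 .
  qed
  have t4: "p * b * ?m * \<Delta> ^ (2 * k - 1) \<le> K ^ (2 * k - 1) * (\<eta> * D)"
  proof -
    have "p * b * ?m * \<Delta> ^ (2 * k - 1) = d * b * \<Delta> ^ (2 * k - 1)" unfolding d by simp
    also have "\<dots> \<le> d * (\<eta> * d) * (K ^ (2 * k - 1) * d ^ (2 * k - 1))"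
      using \<Delta>pow[of "2 * k - 1"] b(1) b_nonneg d_pos \<eta>(1) \<Delta>_nonneg by (intro mult_mono) auto
    also have "\<dots> = K ^ (2 * k - 1) * (\<eta> * (d * d ^ (2 * k - 1) * d))" by (simp only: mult_ac)
    finally show ?thesis unfolding D2 .
  qed
  have t5: "b * \<Delta> ^ (2 * k) \<le> K ^ (2 * k) * (\<eta> * D)"
  proof -
    have "b * \<Delta> ^ (2 * k) \<le> (\<eta> * d) * (K ^ (2 * k) * d ^ (2 * k))"
      using \<Delta>pow[of "2 * k"] b(1) b_nonneg d_pos \<eta>(1) \<Delta>_nonneg by (intro mult_mono) auto
    also have "\<dots> = K ^ (2 * k) * (\<eta> * (d ^ (2 * k) * d))" by (simp only: mult_ac)
    finally show ?thesis unfolding D1 .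
  qed
  have t6: "b * (?m * b ^ (2 * k - 2) * \<Delta>) \<le> K * (\<eta> * D)"
  proof -
    have "b * b ^ (2 * k - 2) = b ^ (Suc (2 * k - 2))" by simp
    also have "Suc (2 * k - 2) = 2 * k - 1" using k_pos by auto
    finally have "b * (?m * b ^ (2 * k - 2) * \<Delta>) = (?m * b ^ (2 * k - 1)) * \<Delta>"
      by (metis mult.assoc mult.left_commute)
    also have "\<dots> \<le> (\<eta> * d ^ (2 * k)) * (K * d)"
      using \<eta>(1) d_pos \<Delta>_nonneg by (intro mult_mono[OF b(2) K(1)]) auto
    also have "\<dots> = K * (\<eta> * (d ^ (2 * k) * d))" by (simp only: mult_ac)
    finally show ?thesis unfolding D1 .
  qed
  have t: "(\<Sum>z\<in>U. mpow U A (2 * k + 1) z z)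
      \<le> real ((2 * k + 1)\<^sup>2) * 16 ^ k * (K ^ (2 * k + 1) + 2 * K ^ (2 * k) + K\<^sup>2) * (\<eta> * D)" (is "?t \<le> ?T")
  proof (cases "k = 1")
    case True
    have "?t \<le> 0" using closed_odd_walks_upper[OF A_eq irrefl no] True by simp
    also have "0 \<le> ?T"
      using K0 \<eta>(1) D_pos by (intro mult_nonneg_nonneg add_nonneg_nonneg) auto
    finally show ?thesis .
  next
    case False
    then have k2: "2 \<le> k" using k_pos by simp
    have "?t \<le> real ((2 * k + 1)\<^sup>2) * (16 ^ k * (\<Delta> ^ (2 * k + 1) / card U + 2 * \<Delta> ^ (2 * k) + card U * b ^ (2 * k - 3) * \<Delta>\<^sup>2))"
      using closed_odd_walks_upper[OF A_eq irrefl no] False by simp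
    also have "\<dots> \<le> real ((2 * k + 1)\<^sup>2) * (16 ^ k * (K ^ (2 * k + 1) * (\<eta> * D) + 2 * (K ^ (2 * k) * (\<eta> * D)) + K\<^sup>2 * (\<eta> * D)))"
      by (intro mult_left_mono add_mono t1 t2 t3 k2) auto
    also have "\<dots> = ?T" by (simp only: distrib_left distrib_right mult.assoc)
    finally show ?thesis .
  qed
  have sd: "d \<le> 2 * s"
    using s \<delta> d_pos by (smt (verit) mult_le_cancel_right1)
  have pos: "0 \<le> d * (d / 2) ^ (2 * k - 1)" using d_pos by simp
  have "\<delta> * D / 4 ^ k = d * (d / 2) ^ (2 * k - 1) * (\<delta> * d / 2)"
  proof -
    have "(2::real) ^ (2 * k - 1) * 2 = 2 ^ (Suc (2 * k - 1))" by simp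
    also have "Suc (2 * k - 1) = 2 * k" using k_pos by auto
    also have "(2::real) ^ (2 * k) = 4 ^ k" by (simp add: power_mult)
    finally have e: "(2::real) ^ (2 * k - 1) * 2 = 4 ^ k" .
    have "d * (d / 2) ^ (2 * k - 1) * (\<delta> * d / 2) = \<delta> * (d * d ^ (2 * k - 1) * d) / (2 ^ (2 * k - 1) * 2)"
      by (simp add: power_divide mult_ac)
    then show ?thesis unfolding D2 e by simp
  qed
  also have "\<dots> \<le> d * s ^ (2 * k - 1) * (2 * s - d)"
    using sd s pos d_pos \<delta> s_nonneg
    by (intro mult_mono mult_left_mono power_mono) (auto simp: algebra_simps)
  also have "\<dots> = p / ?m * s ^ (2 * k - 1) * (2 * s - p * ?m) * ?m\<^sup>2"
    unfolding d using card_ge_1 by (simp add: power2_eq_square)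
  also have "\<dots> \<le> ?t + p * b * ?m * \<Delta> ^ (2 * k - 1)
       + 3 * b * (4 ^ k * (\<Delta> ^ (2 * k) + ?m * b ^ (2 * k - 2) * \<Delta>))"
    using sd unfolding d by (rule closed_odd_walks_lower)
  also have "\<dots> = ?t + p * b * ?m * \<Delta> ^ (2 * k - 1)
       + 3 * 4 ^ k * (b * \<Delta> ^ (2 * k) + b * (?m * b ^ (2 * k - 2) * \<Delta>))"
    by (simp add: distrib_left mult_ac)
  also have "\<dots> \<le> ?T + K ^ (2 * k - 1) * (\<eta> * D) + 3 * 4 ^ k * (K ^ (2 * k) * (\<eta> * D) + K * (\<eta> * D))"
    by (intro add_mono mult_left_mono t t4 t5 t6) auto
  also have "\<dots> = error_const k K * \<eta> * D"
    unfolding error_const_def by (simp only: distrib_right distrib_left mult.assoc)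
  finally have "\<delta> * D \<le> 4 ^ k * error_const k K * \<eta> * D"
    by (simp add: divide_le_eq mult_ac)
  with D_pos \<eta>(2) show False by simp
qed

end

section \<open>Jumbled graphs\<close>

lemma contains_cycle_of_closed_walk:
  assumes H: "finite_simple_graph H" and L: "1 \<le> L"
    and xs: "xs \<in> walk_lists U (\<lambda>x y. {x, y} \<in> edges H) L x x" and dist: "distinct (take L xs)"
  shows "contains_copy H (cycle_graph L)"
proof -
  have len: "length xs = Suc L" and ends: "xs ! 0 = xs ! L"
    and edge: "\<And>i. i < L \<Longrightarrow> {xs ! i, xs ! Suc i} \<in> edges H"
    using xs by (auto simp: walk_lists_def)
  have "inj_on ((!) xs) {..<L}"
    using dist len by (auto simp: inj_on_def distinct_conv_nth)
  moreover have "xs ! i \<in> verts H" if "i < L" for i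
    using edge[OF that] H by (auto simp: finite_simple_graph_def nsets_def)
  moreover have "(!) xs ` {i, Suc i mod L} \<in> edges H" if "i < L" for i
  proof (cases "Suc i = L")
    case True
    with edge[OF that] ends show ?thesis by simp
  next
    case False
    with edge[OF that] that show ?thesis by simp
  qed
  ultimately show ?thesis
    unfolding contains_copy_def cycle_graph_def by (intro exI[of _ "(!) xs"]) auto
qed

definition adj :: "'a set set \<Rightarrow> 'a \<Rightarrow> 'a \<Rightarrow> real" where
  "adj E x y = of_bool ({x, y} \<in> E)"

lemma adj_sym: "adj E x y = adj E y x"
  by (simp add: adj_def insert_commute)

lemma sum_adj_disjoint:
  assumes "finite X" "finite Y" "X \<inter> Y = {}"
  shows "(\<Sum>x\<in>X. \<Sum>y\<in>Y. adj (edges G) x y) = edges_between G X Y"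
proof -
  let ?S = "{t \<in> X \<times> Y. {fst t, snd t} \<in> edges G}"
  have "(\<Sum>x\<in>X. \<Sum>y\<in>Y. adj (edges G) x y) = (\<Sum>t\<in>X \<times> Y. of_bool ({fst t, snd t} \<in> edges G))"
    by (simp add: adj_def sum.cartesian_product case_prod_unfold)
  also have "\<dots> = (\<Sum>t\<in>?S. 1)"
    using assms by (intro sum.mono_neutral_cong_right) auto
  also have "\<dots> = card ?S" by simp
  also have "card ?S = card (edges G \<inter> pairs_between X Y)"
  proof (rule bij_betw_same_card)
    have "inj_on (\<lambda>t. {fst t, snd t}) (X \<times> Y)"
      using assms by (auto simp: inj_on_def doubleton_eq_iff)
    then have "inj_on (\<lambda>t. {fst t, snd t}) ?S" by (rule inj_on_subset) auto
    moreover have "(\<lambda>t. {fst t, snd t}) ` ?S = edges G \<inter> pairs_between X Y"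
      using assms by (auto simp: pairs_between_def image_iff) blast+
    ultimately show "bij_betw (\<lambda>t. {fst t, snd t}) ?S (edges G \<inter> pairs_between X Y)"
      by (simp add: bij_betw_def)
  qed
  finally show ?thesis by (simp add: edges_between_def)
qed

lemma adj_irrefl: "finite_simple_graph G \<Longrightarrow> adj (edges G) x x = 0"
  by (auto simp: adj_def finite_simple_graph_def nsets_def)

lemma finite_edges: "finite_simple_graph G \<Longrightarrow> finite (edges G)"
  unfolding finite_simple_graph_def by (meson finite_imp_finite_nsets finite_subset)

lemma sum_adj_self:
  assumes "finite Z" and G: "finite_simple_graph G"
  shows "(\<Sum>x\<in>Z. \<Sum>y\<in>Z. adj (edges G) x y) = 2 * edges_between G Z Z"
  using assms(1)
proof (induction Z)
  case empty
  then show ?case by (simp add: edges_between_def pairs_between_def)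
next
  case (insert z Z)
  have pb: "edges G \<inter> pairs_between (insert z Z) (insert z Z)
      = (edges G \<inter> pairs_between {z} Z) \<union> (edges G \<inter> pairs_between Z Z)"
    by (auto simp: pairs_between_def insert_commute)
  have "edges_between G (insert z Z) (insert z Z) = edges_between G {z} Z + edges_between G Z Z"
    unfolding edges_between_def pb using insert finite_edges[OF G]
    by (intro card_Un_disjoint) (auto simp: pairs_between_def doubleton_eq_iff)
  moreover have "(\<Sum>y\<in>Z. adj (edges G) z y) = edges_between G {z} Z"
    using sum_adj_disjoint[of "{z}" Z G] insert by simp
  moreover have "(\<Sum>x\<in>Z. adj (edges G) x z) = (\<Sum>y\<in>Z. adj (edges G) z y)"
    by (intro sum.cong refl adj_sym)
  ultimately show ?case
    using insert by (simp add: sum.distrib adj_irrefl[OF G])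
qed

text \<open>
  Summing over ordered pairs counts the edges inside the intersection Z of X and Y twice. Hence X and
  Y are split into disjoint pieces and Z. The diagonal pairs of Z carry no edges, which costs p |Z|.
\<close>

lemma jumbled_cut_bound:
  assumes G: "finite_simple_graph G" and J: "jumbled p \<beta> G" and p: "0 \<le> p" and \<beta>: "0 \<le> \<beta>"
    and XY: "X \<subseteq> verts G" "Y \<subseteq> verts G"
  shows "\<bar>\<Sum>x\<in>X. \<Sum>y\<in>Y. adj (edges G) x y - p\<bar> \<le> (4 * \<beta> + p) * sqrt (card X * card Y)"
proof -
  define e where "e P Q = (\<Sum>x\<in>P. \<Sum>y\<in>Q. adj (edges G) x y - p)" for P Q
  define r where "r = sqrt (card X * card Y)"
  define Z where "Z = X \<inter> Y"
  have finV: "finite (verts G)" using G by (simp add: finite_simple_graph_def)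
  have fin: "finite X" "finite Y" using XY finV finite_subset by auto
  have e_eq: "e P Q = (\<Sum>x\<in>P. \<Sum>y\<in>Q. adj (edges G) x y) - p * (real (card P) * real (card Q))" for P Q
    unfolding e_def by (simp add: sum_subtractf)
  have disj: "\<bar>e P Q\<bar> \<le> \<beta> * r" if PQ: "P \<subseteq> X" "Q \<subseteq> Y" "P \<inter> Q = {}" for P Q
  proof -
    have sub: "P \<subseteq> verts G" "Q \<subseteq> verts G" using PQ XY by auto
    have f: "finite P" "finite Q" using sub finV finite_subset by auto
    have "\<bar>e P Q\<bar> = \<bar>real (edges_between G P Q) - p * real (vol P Q)\<bar>"
      unfolding e_eq sum_adj_disjoint[OF f PQ(3)] vol_disjoint[OF PQ(3)] by simp
    also have "\<dots> \<le> \<beta> * sqrt (real (vol P Q))" using J sub by (simp add: jumbled_def)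
    also have "\<dots> \<le> \<beta> * r"
      unfolding r_def vol_disjoint[OF PQ(3)] using PQ fin \<beta>
      by (intro mult_left_mono real_sqrt_le_mono) (auto simp flip: of_nat_mult intro!: mult_mono card_mono)
    finally show ?thesis .
  qed
  have "real (card Z) = sqrt (real (card Z) * real (card Z))" by simp
  also have "\<dots> \<le> r"
    unfolding r_def Z_def using fin by (intro real_sqrt_le_mono) (auto intro!: mult_mono card_mono)
  finally have Zr: "real (card Z) \<le> r" .
  have self: "\<bar>e Z Z\<bar> \<le> 2 * \<beta> * r + p * r"
  proof -
    have subZ: "Z \<subseteq> verts G" and finZ: "finite Z" using XY fin by (auto simp: Z_def)
    have v: "2 * real (vol Z Z) = real (card Z) * (real (card Z) - 1)"
    proof -
      have "even (card Z * (card Z - 1))" by (cases "card Z") auto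
      then have "2 * (card Z choose 2) = card Z * (card Z - 1)"
        unfolding choose_two by (rule dvd_mult_div_cancel)
      then have "2 * real (card Z choose 2) = real (card Z * (card Z - 1))" by (metis of_nat_mult of_nat_numeral)
      then show ?thesis by (cases "card Z") (auto simp: vol_self[OF finZ] algebra_simps)
    qed
    then have sq: "real (card Z) * real (card Z) = real (card Z) + 2 * real (vol Z Z)"
      by (simp add: algebra_simps)
    have "e Z Z = 2 * (real (edges_between G Z Z) - p * real (vol Z Z)) - p * real (card Z)"
      unfolding e_eq sum_adj_self[OF finZ G] sq by (simp add: algebra_simps)
    also have "\<bar>\<dots>\<bar> \<le> 2 * (\<beta> * sqrt (real (vol Z Z))) + p * real (card Z)"
    proof -
      have "\<bar>real (edges_between G Z Z) - p * real (vol Z Z)\<bar> \<le> \<beta> * sqrt (real (vol Z Z))"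
        using J subZ by (simp add: jumbled_def)
      moreover have "0 \<le> p * real (card Z)" using p by simp
      moreover have "\<bar>2 * x - y\<bar> \<le> 2 * z + y" if "\<bar>x\<bar> \<le> z" "0 \<le> y" for x y z :: real
        using that by linarith
      ultimately show ?thesis by blast
    qed
    also have "\<dots> \<le> 2 * (\<beta> * r) + p * r"
    proof (intro add_mono mult_left_mono Zr \<beta> p)
      have "real (vol Z Z) \<le> real (card Z) * real (card Z)"
        using v by (simp add: algebra_simps)
      then have "sqrt (real (vol Z Z)) \<le> sqrt (real (card Z) * real (card Z))" by (rule real_sqrt_le_mono)
      then show "sqrt (real (vol Z Z)) \<le> r" using Zr by simp
    qed auto
    finally show ?thesis by simp
  qed
  have X: "(\<Sum>x\<in>X. g x) = (\<Sum>x\<in>X - Y. g x) + (\<Sum>x\<in>Z. g x)" for g :: "'a \<Rightarrow> real"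
    unfolding Z_def using fin by (subst sum.union_disjoint[symmetric]) (auto intro!: sum.cong)
  have Y: "(\<Sum>x\<in>Y. g x) = (\<Sum>x\<in>Y - Z. g x) + (\<Sum>x\<in>Z. g x)" for g :: "'a \<Rightarrow> real"
    unfolding Z_def using fin by (subst sum.union_disjoint[symmetric]) (auto intro!: sum.cong)
  have "e X Y = e (X - Y) Y + (e Z (Y - Z) + e Z Z)"
    unfolding e_def X Y[of "\<lambda>y. adj (edges G) x y - p" for x] sum.distrib[symmetric] by simp
  moreover have "\<bar>e (X - Y) Y\<bar> \<le> \<beta> * r" "\<bar>e Z (Y - Z)\<bar> \<le> \<beta> * r"
    by (intro disj; auto simp: Z_def)+
  ultimately have "\<bar>e X Y\<bar> \<le> \<beta> * r + (\<beta> * r + (2 * \<beta> * r + p * r))" using self by linarith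
  then show ?thesis unfolding e_def r_def by (simp add: algebra_simps)
qed

text \<open>
  First the vertices of degree more than 2 p n in b are deleted; by the cut bound they carry few edges.
  Then U is chosen to maximize the excess of a over the density 1/2 + \<delta>/2. Removing a vertex cannot
  increase the excess, which forces the minimum degree; and since the excess is of order p n^2 and
  the cut bound limits the edges inside U, the set U is large.
\<close>

lemma dense_core:
  fixes a b :: "'a \<Rightarrow> 'a \<Rightarrow> real" and p c \<delta> :: real
  assumes fin: "finite V" and a_sym: "\<And>x y. a x y = a y x" and a_irrefl: "\<And>x. a x x = 0"
    and ab: "\<And>x y. 0 \<le> a x y \<and> a x y \<le> b x y"
    and cut: "\<And>X Y. X \<subseteq> V \<Longrightarrow> Y \<subseteq> V \<Longrightarrow> \<bar>\<Sum>x\<in>X. \<Sum>y\<in>Y. b x y - p\<bar> \<le> c * sqrt (card X * card Y)"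
    and \<delta>: "0 < \<delta>" "\<delta> \<le> 1 / 4" and p: "0 < p" and c: "0 \<le> c" "c \<le> \<delta> / 8 * (p * card V)"
    and large: "8 \<le> \<delta> * card V"
    and dense: "(1 / 2 + \<delta>) * p * (real (card V) * (real (card V) - 1)) \<le> (\<Sum>x\<in>V. \<Sum>y\<in>V. a x y)"
  shows "\<exists>U\<subseteq>V. \<delta> / 2 * card V \<le> card U
    \<and> (\<forall>x\<in>U. (\<Sum>y\<in>U. b x y) \<le> 2 * p * card V)
    \<and> (\<forall>x\<in>U. (1 + \<delta>) * p * (card U - 1 / 2) \<le> 2 * (\<Sum>y\<in>U. a x y))"
proof -
  define n where "n = real (card V)"
  define S where "S f X Y = (\<Sum>x\<in>X. \<Sum>y\<in>Y. f x y)" for f :: "'a \<Rightarrow> 'a \<Rightarrow> real" and X Y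
  have n_pos: "0 < n" using large by (cases "n = 0") (auto simp: n_def)
  have S_b: "\<bar>S b X Y - p * (real (card X) * real (card Y))\<bar> \<le> c * sqrt (card X * card Y)"
    if "X \<subseteq> V" "Y \<subseteq> V" for X Y
    using cut[OF that] unfolding S_def by (simp add: sum_subtractf mult_ac)
  have S_mono: "S f X Y \<le> S g X Y" if "\<And>x y. f x y \<le> g x y" for f g X Y
    unfolding S_def by (intro sum_mono that)
  \<comment> \<open>W has more than twice the expected number of edges, and the cut bound allows this only if W is small\<close>
  define W where "W = {x\<in>V. 2 * p * n < (\<Sum>y\<in>V. b x y)}"
  define V' where "V' = V - W"
  have WV: "W \<subseteq> V" by (auto simp: W_def)
  define r where "r = sqrt (card W * n)"
  have r_nonneg: "0 \<le> r" and r2: "r * r = card W * n"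
    using n_pos unfolding r_def by auto
  have SW: "S b W V \<le> p * (r * r) + c * r"
    using S_b[OF WV order_refl] unfolding r2 unfolding r_def n_def by simp
  have "(\<Sum>x\<in>W. 2 * p * n) \<le> S b W V"
    unfolding S_def W_def by (intro sum_mono) auto
  then have "2 * p * (r * r) \<le> S b W V" unfolding r2 by (simp add: mult_ac)
  with SW have "p * r * r \<le> c * r" by simp
  then have pr: "p * r \<le> c" using r_nonneg c(1) by (cases "r = 0") auto
  have "S b W V \<le> 2 * (c * r)" using SW \<open>p * r * r \<le> c * r\<close> by simp
  also have "c * r \<le> \<delta> / 8 * (p * n) * r" using c(2) r_nonneg unfolding n_def by (intro mult_right_mono)
  also have "\<dots> = \<delta> / 8 * n * (p * r)" by simp
  also have "\<dots> \<le> \<delta> / 8 * n * (\<delta> / 8 * (p * n))"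
    using pr c(2) \<delta> n_pos unfolding n_def by (intro mult_left_mono) auto
  also have "\<dots> = (\<delta> * \<delta>) * (p * n * n) / 64" by simp
  also have "\<dots> \<le> (\<delta> * (1 / 4)) * (p * n * n) / 64"
    using \<delta> p n_pos by (intro divide_right_mono mult_right_mono mult_left_mono) auto
  finally have SbW: "S b W V \<le> \<delta> / 128 * (p * n * n)" by (simp add: mult_ac)
  have V: "(\<Sum>x\<in>V. g x) = (\<Sum>x\<in>V'. g x) + (\<Sum>x\<in>W. g x)" for g :: "'a \<Rightarrow> real"
    unfolding V'_def by (rule sum.subset_diff[OF WV fin])
  have "S a V V = S a V' V' + S a V' W + S a W V"
    unfolding S_def V sum.distrib by simp
  moreover have "S a V' W \<le> S a W V"
  proof -
    have "S a V' W = S a W V'" unfolding S_def by (subst sum.swap) (simp add: a_sym)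
    also have "\<dots> \<le> S a W V" unfolding S_def V'_def using ab fin by (intro sum_mono sum_mono2) auto
    finally show ?thesis .
  qed
  moreover have "S a W V \<le> S b W V" using ab by (intro S_mono) auto
  moreover have "(1 / 2 + \<delta>) * p * (n * (n - 1)) \<le> S a V V"
    using dense unfolding S_def n_def .
  moreover have "(1 / 2 + \<delta>) * p * (n * (n - 1)) \<ge> (1 / 2 + \<delta> - \<delta> / 8) * (p * n * n)"
  proof -
    have "(1 / 2 + \<delta>) * (p * n) \<le> 1 * (p * n)" using \<delta> p n_pos by (intro mult_right_mono) auto
    also have "\<dots> \<le> (\<delta> * n / 8) * (p * n)" using large p n_pos unfolding n_def by (intro mult_right_mono) auto
    finally show ?thesis by (simp add: algebra_simps diff_divide_distrib)
  qed
  moreover have \<delta>q: "0 \<le> \<delta> * (p * n * n)" using p n_pos \<delta> by simp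
  \<comment> \<open>3/4 leaves \<delta>/4 above the density 1/2 + \<delta>/2 that the excess below subtracts\<close>
  ultimately have SV': "(1 / 2 + 3 / 4 * \<delta>) * (p * n * n) \<le> S a V' V'"
    using SbW \<delta>q by (simp add: algebra_simps)
  define \<phi> where "\<phi> U = S a U U - (1 / 2 + \<delta> / 2) * p * (real (card U))\<^sup>2" for U
  have finV': "finite V'" "finite (Pow V')" using fin by (auto simp: V'_def)
  obtain U where U: "U \<subseteq> V'" and max: "\<And>U'. U' \<subseteq> V' \<Longrightarrow> \<phi> U' \<le> \<phi> U"
  proof -
    have "Max (\<phi> ` Pow V') \<in> \<phi> ` Pow V'" using finV' by (intro Max_in) auto
    then obtain U where "U \<subseteq> V'" "\<phi> U = Max (\<phi> ` Pow V')" by auto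
    with finV' that show thesis by (metis Max_ge PowI finite_imageI imageI)
  qed
  have UV: "U \<subseteq> V" and finU: "finite U" using U fin finite_subset by (auto simp: V'_def)
  define m where "m = real (card U)"
  have mn: "m \<le> n" "0 \<le> m" unfolding m_def n_def using UV fin by (auto intro: card_mono)
  have "card V' \<le> card V" using fin by (auto simp: V'_def intro: card_mono)
  then have "(real (card V'))\<^sup>2 \<le> n\<^sup>2" unfolding n_def by (intro power_mono) auto
  then have "(1 / 2 + \<delta> / 2) * p * (real (card V'))\<^sup>2 \<le> (1 / 2 + \<delta> / 2) * p * n\<^sup>2"
    using \<delta> p by (intro mult_left_mono) auto
  with SV' have "\<delta> / 4 * (p * n * n) \<le> \<phi> V'" unfolding \<phi>_def by (simp add: algebra_simps power2_eq_square)
  also have "\<dots> \<le> \<phi> U" by (rule max) simp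
  also have "\<phi> U \<le> S b U U - (1 / 2 + \<delta> / 2) * p * m\<^sup>2"
    unfolding \<phi>_def m_def using ab by (intro diff_right_mono S_mono) auto
  also have "S b U U \<le> p * (m * m) + c * m"
    using S_b[OF UV UV] unfolding m_def by simp
  also have "c * m \<le> \<delta> / 8 * (p * n) * n"
    using c mn n_pos \<delta> p unfolding n_def[symmetric] by (intro mult_mono) auto
  finally have "\<delta> / 8 * (p * n * n) \<le> (1 / 2 - \<delta> / 2) * (p * m * m)"
    by (simp add: algebra_simps power2_eq_square)
  also have "\<dots> \<le> (1 / 2) * (p * m * m)" using \<delta> p mn by (intro mult_right_mono) auto
  finally have "p * (\<delta> * (n * n)) \<le> p * (4 * (m * m))" by (simp add: mult_ac)
  then have "\<delta> * (n * n) \<le> 4 * (m * m)" using p by simp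
  moreover have "(\<delta> * \<delta>) * (n * n) \<le> (\<delta> * 1) * (n * n)" using \<delta> n_pos by (intro mult_right_mono mult_left_mono) auto
  ultimately have "(\<delta> / 2 * n)\<^sup>2 \<le> m\<^sup>2" by (simp add: power2_eq_square mult_ac)
  then have m_ge: "\<delta> / 2 * n \<le> m" using mn(2) by (rule power2_le_imp_le)
  have "(1 + \<delta>) * p * (m - 1 / 2) \<le> 2 * (\<Sum>y\<in>U. a x y)" if x: "x \<in> U" for x
  proof -
    have U': "(\<Sum>y\<in>U. g y) = (\<Sum>y\<in>U - {x}. g y) + g x" for g :: "'a \<Rightarrow> real"
      using sum.remove[OF finU x, of g] by simp
    have "S a U U = S a (U - {x}) (U - {x}) + (\<Sum>y\<in>U - {x}. a y x) + (\<Sum>y\<in>U - {x}. a x y)"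
      unfolding S_def U' sum.distrib by (simp add: a_irrefl)
    also have "(\<Sum>y\<in>U - {x}. a y x) = (\<Sum>y\<in>U. a x y)" unfolding U' by (simp add: a_irrefl a_sym)
    also have "(\<Sum>y\<in>U - {x}. a x y) = (\<Sum>y\<in>U. a x y)" unfolding U' by (simp add: a_irrefl)
    finally have SU: "S a U U = S a (U - {x}) (U - {x}) + 2 * (\<Sum>y\<in>U. a x y)" by simp
    have c1: "real (card (U - {x})) = m - 1"
      unfolding m_def using card_Suc_Diff1[OF finU x] by linarith
    have "\<phi> (U - {x}) \<le> \<phi> U" using U by (intro max) auto
    then show ?thesis
      unfolding \<phi>_def SU c1 m_def[symmetric]
      by (simp add: algebra_simps power2_eq_square add_divide_distrib diff_divide_distrib)
  qed
  moreover have "(\<Sum>y\<in>U. b x y) \<le> 2 * p * n" if "x \<in> U" for x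
  proof -
    have "0 \<le> b x y" for y using ab[of x y] by linarith
    then have "(\<Sum>y\<in>U. b x y) \<le> (\<Sum>y\<in>V. b x y)" using UV fin by (intro sum_mono2) auto
    also have "\<dots> \<le> 2 * p * n" using that U by (auto simp: V'_def W_def not_less)
    finally show ?thesis .
  qed
  ultimately show ?thesis using UV m_ge unfolding m_def n_def by blast
qed

lemma bilinear_bound_adj:
  assumes G: "finite_simple_graph G" and J: "jumbled p \<beta> G" and p: "0 \<le> p" and \<beta>: "0 \<le> \<beta>"
    and U: "U \<subseteq> verts G" and N: "N < 2 ^ L"
    and f: "\<And>x. x \<in> U \<Longrightarrow> f x \<in> \<nat> \<and> f x \<le> real N" and g: "\<And>x. x \<in> U \<Longrightarrow> g x \<in> \<nat> \<and> g x \<le> real N"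
  shows "\<bar>\<Sum>x\<in>U. \<Sum>y\<in>U. f x * (adj (edges G) x y - p) * g y\<bar>
    \<le> real L * (4 * \<beta> + p) * L2_set f U * L2_set g U"
proof -
  have fin: "finite U" using G U finite_subset by (auto simp: finite_simple_graph_def)
  have nat: "\<exists>F :: 'a \<Rightarrow> nat. \<forall>x\<in>U. f x = real (F x) \<and> F x < 2 ^ L"
    if "\<And>x. x \<in> U \<Longrightarrow> f x \<in> \<nat> \<and> f x \<le> real N" for f :: "'a \<Rightarrow> real"
  proof -
    have "\<exists>i. f x = real i \<and> i < 2 ^ L" if x: "x \<in> U" for x
    proof -
      obtain i where i: "f x = real i" using \<open>\<And>x. x \<in> U \<Longrightarrow> f x \<in> \<nat> \<and> f x \<le> real N\<close>[OF x] Nats_cases by metis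
      with \<open>\<And>x. x \<in> U \<Longrightarrow> f x \<in> \<nat> \<and> f x \<le> real N\<close>[OF x] N show ?thesis by auto
    qed
    then show ?thesis by metis
  qed
  have "\<exists>F. \<forall>x\<in>U. f x = real (F x) \<and> F x < 2 ^ L" using f by (rule nat)
  then obtain F where F: "\<And>x. x \<in> U \<Longrightarrow> f x = real (F x) \<and> F x < 2 ^ L" by blast
  have "\<exists>F. \<forall>x\<in>U. g x = real (F x) \<and> F x < 2 ^ L" using g by (rule nat)
  then obtain G' where G': "\<And>x. x \<in> U \<Longrightarrow> g x = real (G' x) \<and> G' x < 2 ^ L" by blast
  have "\<bar>\<Sum>x\<in>U. \<Sum>y\<in>U. F x * (adj (edges G) x y - p) * G' y\<bar>
    \<le> real L * (4 * \<beta> + p) * L2_set (\<lambda>x. real (F x)) U * L2_set (\<lambda>x. real (G' x)) U"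
    using F G' p \<beta> U by (intro bilinear_bound_of_cut_bound fin jumbled_cut_bound[OF G J p \<beta>]) auto
  moreover have "L2_set f U = L2_set (\<lambda>x. real (F x)) U" "L2_set g U = L2_set (\<lambda>x. real (G' x)) U"
    using F G' by (auto intro: L2_set_cong)
  ultimately show ?thesis using F G' by (simp cong: sum.cong)
qed

section \<open>Odd cycles in dense subgraphs of jumbled graphs\<close>

text \<open>
  The number L of digits multiplies the cut bound 4 \<beta> + p to the bilinear bound e of the core U. The
  factor (\<delta>/2)^(2k) in the hypothesis on it makes up for passing from n to the at least \<delta> n / 2
  vertices of U.
\<close>

lemma contains_odd_cycle_of_dense:
  fixes \<Gamma> H :: "'a graph" and k L :: nat and p \<beta> \<delta> \<eta> :: real
  defines "n \<equiv> real (card (verts \<Gamma>))"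
  assumes G: "finite_simple_graph \<Gamma>" and H: "subgraph H \<Gamma>" and J: "jumbled p \<beta> \<Gamma>"
    and k: "1 \<le> k" and \<delta>: "0 < \<delta>" "\<delta> \<le> 1 / 4" and p: "0 < p" "p \<le> 1" and \<beta>: "0 \<le> \<beta>"
    and \<eta>: "0 < \<eta>" "\<eta> \<le> \<delta> / 8" "4 ^ k * error_const k (4 / \<delta>) * \<eta> < \<delta> / 2"
    and L: "card (verts \<Gamma>) ^ (k - 1) < 2 ^ L"
    and b: "real L * (4 * \<beta> + p) \<le> \<eta> / 8 * (\<delta> / 2) ^ (2 * k) * (p powr (1 + 1 / (2 * real k - 1)) * n)"
    and cases: "1 / 2 < p \<or> 1 / 2 \<le> \<beta>"
    and n: "16 \<le> \<eta> * \<delta> * n"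
    and dense: "(1 / 2 + \<delta>) * p * (n * (n - 1)) \<le> 2 * real (card (edges H))"
  shows "contains_copy H (cycle_graph (2 * k + 1))"
proof -
  define V where "V = verts \<Gamma>"
  define a where "a = adj (edges H)"
  define B where "B = adj (edges \<Gamma>)"
  define c where "c = 4 * \<beta> + p"
  define e where "e = real L * c"
  define g where "g = \<eta> / 8 * (\<delta> / 2) ^ (2 * k)"
  define P where "P = p powr (1 + 1 / (2 * real k - 1))"
  have finV: "finite V" using G by (simp add: finite_simple_graph_def V_def)
  have Hg: "finite_simple_graph H" and Hsub: "verts H \<subseteq> V" "edges H \<subseteq> edges \<Gamma>"
    using H by (auto simp: subgraph_def V_def)
  have n_pos: "0 < n" using n by (cases "n = 0") (auto simp: n_def)
  have c_pos: "0 < c" unfolding c_def using p \<beta> by simp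
  have "card V \<noteq> 0" using n_pos unfolding n_def V_def by simp
  then have "1 \<le> card V ^ (k - 1)" by simp
  with L have "L \<noteq> 0" unfolding V_def by (metis not_less power_0)
  then have ce: "c \<le> e" unfolding e_def using c_pos by simp
  have g_pos: "0 < g" unfolding g_def using \<eta> \<delta> by simp
  have "(\<delta> / 2) ^ (2 * k) \<le> (\<delta> / 2) ^ 1" using k \<delta> by (intro power_decreasing) auto
  then have g_le: "g \<le> \<eta> / 8 * (\<delta> / 2)" unfolding g_def using \<eta> by (intro mult_left_mono) auto
  also have "\<dots> \<le> \<eta> / 8 * 1" using \<delta> \<eta> by (intro mult_left_mono) auto
  finally have g_le': "g \<le> \<eta> / 8" by simp
  have P_le: "P \<le> p"
  proof -
    have "P \<le> p powr 1" unfolding P_def using p k by (intro powr_mono') auto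
    then show ?thesis using p by simp
  qed
  have P_pos: "0 < P" unfolding P_def using p by simp
  have eP: "e \<le> g * (P * n)" using b unfolding e_def c_def g_def P_def .
  also have "\<dots> \<le> g * (p * n)" using P_le g_pos n_pos by (intro mult_left_mono mult_right_mono) auto
  finally have e_le: "e \<le> g * (p * n)" .
  have a_edges: "(\<Sum>x\<in>V. \<Sum>y\<in>V. a x y) = 2 * real (card (edges H))"
  proof -
    have "edges H \<subseteq> pairs_between V V"
    proof
      fix f assume "f \<in> edges H"
      then have "f \<in> nsets (verts H) 2" using Hg by (auto simp: finite_simple_graph_def)
      with Hsub(1) show "f \<in> pairs_between V V" by (auto simp: nsets_2_eq pairs_between_def)
    qed
    then have "edges_between H V V = card (edges H)"
      unfolding edges_between_def by (simp add: Int_absorb2)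
    then show ?thesis unfolding a_def using sum_adj_self[OF finV Hg] by simp
  qed
  have ab: "0 \<le> a x y \<and> a x y \<le> B x y" for x y
    unfolding a_def B_def adj_def using Hsub by auto
  have cut: "\<bar>\<Sum>x\<in>X. \<Sum>y\<in>Y. B x y - p\<bar> \<le> c * sqrt (card X * card Y)" if "X \<subseteq> V" "Y \<subseteq> V" for X Y
    unfolding B_def c_def using p \<beta> that unfolding V_def by (intro jumbled_cut_bound[OF G J]) auto
  have pn_pos: "0 < p * n" using p n_pos by simp
  have c_le: "c \<le> \<delta> / 8 * (p * n)"
  proof -
    have "g \<le> \<delta> / 8" using g_le' \<eta> by linarith
    then have "g * (p * n) \<le> \<delta> / 8 * (p * n)" using pn_pos by (intro mult_right_mono) auto
    with ce e_le show ?thesis by linarith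
  qed
  have \<eta>\<delta>: "\<eta> * \<delta> * n \<le> \<delta> * n"
    using \<eta>(1,2) \<delta> n_pos by (simp add: mult_left_le_one_le mult_right_mono)
  have a_sym: "a x y = a y x" and a_irrefl: "a x x = 0" for x y
    unfolding a_def by (rule adj_sym, rule adj_irrefl[OF Hg])
  have large: "8 \<le> \<delta> * card V" using n \<eta>\<delta> unfolding n_def V_def by linarith
  have dense': "(1 / 2 + \<delta>) * p * (real (card V) * (real (card V) - 1)) \<le> (\<Sum>x\<in>V. \<Sum>y\<in>V. a x y)"
    using dense unfolding a_edges unfolding n_def V_def .
  have c_le': "c \<le> \<delta> / 8 * (p * real (card V))" using c_le unfolding n_def V_def .
  obtain U where U: "U \<subseteq> V" and m_ge: "\<delta> / 2 * card V \<le> card U"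
    and max_deg: "\<forall>x\<in>U. (\<Sum>y\<in>U. B x y) \<le> 2 * p * card V"
    and min_deg: "\<forall>x\<in>U. (1 + \<delta>) * p * (card U - 1 / 2) \<le> 2 * (\<Sum>y\<in>U. a x y)"
    using dense_core[OF finV a_sym a_irrefl ab cut \<delta> p(1) less_imp_le[OF c_pos] c_le' large dense']
    by blast
  define m where "m = real (card U)"
  define d where "d = p * m"
  define s where "s = (1 + \<delta>) * p * (m - 1 / 2) / 2"
  have finU: "finite U" using U finV finite_subset by auto
  have m_ge: "\<delta> / 2 * n \<le> m" using m_ge unfolding m_def n_def V_def .
  have max_deg: "(\<Sum>y\<in>U. B x y) \<le> 2 * p * n" if "x \<in> U" for x
    using max_deg that unfolding n_def V_def by blast
  have mn: "m \<le> n" unfolding m_def n_def using U finV by (auto simp: V_def intro: card_mono)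
  have \<eta>m: "8 \<le> \<eta> * m"
  proof -
    have "\<eta> * (\<delta> / 2 * n) \<le> \<eta> * m" using m_ge \<eta> by (intro mult_left_mono) auto
    with n show ?thesis by simp
  qed
  have m_pos: "0 < m" using \<eta>m by (cases "m = 0") (auto simp: m_def)
  have \<delta>m: "64 \<le> \<delta> * m"
  proof -
    have "8 * \<eta> * m \<le> \<delta> * m" using \<eta>(2) m_pos by (intro mult_right_mono) auto
    with \<eta>m show ?thesis by simp
  qed
  have d_pos: "0 < d" unfolding d_def using p m_pos by simp
  have pnd: "\<delta> / 2 * (p * n) \<le> d"
    unfolding d_def using mult_left_mono[OF m_ge, of p] p by (simp add: mult_ac)
  have m1: "1 \<le> m"
  proof -
    have "\<delta> * m \<le> 1 * m" using \<delta> m_pos by (intro mult_right_mono) auto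
    with \<delta>m show ?thesis by simp
  qed
  have s2: "(1 + \<delta> / 2) * d \<le> 2 * s"
  proof -
    have "(1 + \<delta>) * p \<le> (\<delta> * m) * p" using \<delta>m \<delta> p by (intro mult_right_mono) auto
    then show ?thesis unfolding s_def d_def by (simp add: field_simps)
  qed
  have e8: "e \<le> \<eta> / 8 * d"
  proof -
    have "g * (p * n) \<le> \<eta> / 8 * (\<delta> / 2) * (p * n)" using g_le pn_pos by (intro mult_right_mono) auto
    also have "\<dots> = \<eta> / 8 * (\<delta> / 2 * (p * n))" by simp
    also have "\<dots> \<le> \<eta> / 8 * d" using pnd \<eta> by (intro mult_left_mono) auto
    finally show ?thesis using e_le by linarith
  qed
  have \<eta>d0: "0 < \<eta> * d" using \<eta> d_pos by simp
  have e\<eta>: "e \<le> \<eta> * d" using e8 \<eta>d0 by simp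
  have d_le: "d \<le> p * n" unfolding d_def using mn p by (intro mult_left_mono) auto
  have e_pos: "0 < e" using ce c_pos by linarith
  \<comment> \<open>the exponent of p enters here: the power 2k-1 of P is p^(2k)\<close>
  have me: "m * e ^ (2 * k - 1) \<le> \<eta> / 8 * d ^ (2 * k)"
  proof -
    have q: "Suc (2 * k - 1) = 2 * k" using k by auto
    have Pq: "P ^ (2 * k - 1) = p ^ (2 * k)"
    proof -
      have r: "real (2 * k - 1) = 2 * real k - 1" using k by (simp add: of_nat_diff)
      have "P ^ (2 * k - 1) = P powr (2 * real k - 1)"
        using P_pos by (simp flip: r add: powr_realpow)
      also have "\<dots> = p powr ((1 + 1 / (2 * real k - 1)) * (2 * real k - 1))"
        unfolding P_def powr_powr ..
      also have "(1 + 1 / (2 * real k - 1)) * (2 * real k - 1) = real (2 * k)"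
        using k by (simp add: field_simps)
      also have "p powr real (2 * k) = p ^ (2 * k)" using p by (intro powr_realpow)
      finally show ?thesis .
    qed
    have "g \<le> 1" using g_le' \<eta> \<delta> by linarith
    then have gq: "g ^ (2 * k - 1) \<le> g ^ 1" using g_pos k by (intro power_decreasing) auto
    have "m * e ^ (2 * k - 1) \<le> n * (g * (P * n)) ^ (2 * k - 1)"
      using mn eP e_pos n_pos by (intro mult_mono power_mono) auto
    also have "\<dots> = g ^ (2 * k - 1) * (p ^ (2 * k) * n ^ Suc (2 * k - 1))"
      unfolding power_mult_distrib Pq power_Suc by (simp only: mult_ac)
    also have "\<dots> \<le> g * (p ^ (2 * k) * n ^ Suc (2 * k - 1))"
      using gq n_pos p by (intro mult_right_mono) auto
    also have "\<dots> = \<eta> / 8 * (\<delta> / 2 * (p * n)) ^ (2 * k)"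
      unfolding q g_def by (simp add: power_mult_distrib power_divide)
    also have "\<dots> \<le> \<eta> / 8 * d ^ (2 * k)"
      using pnd pn_pos \<eta> \<delta> by (intro mult_left_mono power_mono) auto
    finally show ?thesis .
  qed
  have adj01: "adj E x y \<in> {0, 1}" for E and x y :: 'a by (simp add: adj_def)
  interpret pseudorandom_pair U B p e "2 * p * n" k a s
  proof
    show "p * real (card U) \<le> 2 * p * n" using d_le pn_pos unfolding d_def m_def by linarith
    show "e \<le> 2 * p * n"
    proof -
      have "\<eta> * d \<le> 1 * d" using \<eta> \<delta> d_pos by (intro mult_right_mono) auto
      with e\<eta> d_le pn_pos show ?thesis by linarith
    qed
    show "U \<noteq> {}" using m_pos unfolding m_def by auto
    show "B x y \<in> {0, 1}" "a x y \<in> {0, 1}" for x y unfolding B_def a_def by (rule adj01)+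
    show "0 \<le> s" unfolding s_def using \<delta> p m1 by simp
    show "\<bar>\<Sum>x\<in>U. \<Sum>y\<in>U. f x * (B x y - p) * h y\<bar> \<le> e * L2_set f U * L2_set h U"
      if "\<And>x. x \<in> U \<Longrightarrow> f x \<in> \<nat> \<and> f x \<le> real (card U) ^ (k - 1)"
        "\<And>x. x \<in> U \<Longrightarrow> h x \<in> \<nat> \<and> h x \<le> real (card U) ^ (k - 1)" for f h
    proof -
      have "card U ^ (k - 1) \<le> card V ^ (k - 1)" using U finV by (intro power_mono card_mono) auto
      then have "card U ^ (k - 1) < 2 ^ L" using L unfolding V_def by linarith
      with that show ?thesis
        unfolding B_def e_def c_def
        using p \<beta> U unfolding V_def
        by (intro bilinear_bound_adj[OF G J _ \<beta> _ _, of U "card U ^ (k - 1)" L f h]) simp_all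
    qed
    show "s \<le> (\<Sum>y\<in>U. a x y)" if "x \<in> U" for x
      using bspec[OF min_deg that] unfolding s_def m_def by simp
  qed (use finU max_deg ab p k e_pos in \<open>auto simp: B_def a_def adj_sym\<close>)
  have \<eta>d: "1 \<le> \<eta> * d"
  proof (cases "1 / 2 < p")
    case True
    then have "1 / 2 * (\<eta> * m) \<le> p * (\<eta> * m)" using \<eta>m by (intro mult_right_mono) auto
    with \<eta>m show ?thesis unfolding d_def by (simp add: mult_ac)
  next
    case False
    with cases have "1 \<le> c" unfolding c_def using p by simp
    with ce e\<eta> show ?thesis by linarith
  qed
  have odd: "m * e ^ (2 * k - 3) \<le> \<eta> * d ^ (2 * k - 1)" if k2: "2 \<le> k"
  proof (cases "1 / 2 < p")
    case True
    have "2 * k - 1 = Suc (Suc (2 * k - 3))" using k2 by auto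
    then have q: "d ^ (2 * k - 1) = d * (d * d ^ (2 * k - 3))" by simp
    have "e \<le> d"
    proof -
      have "\<eta> * d \<le> 1 * d" using \<eta> \<delta> d_pos by (intro mult_right_mono) auto
      with e\<eta> show ?thesis by linarith
    qed
    have "1 / 2 * m \<le> d" unfolding d_def using True m_pos by (intro mult_right_mono) auto
    then have "m * e ^ (2 * k - 3) \<le> (2 * d) * d ^ (2 * k - 3)"
      using \<open>e \<le> d\<close> e_pos d_pos by (intro mult_mono power_mono) auto
    also have "\<dots> \<le> (\<eta> * d) * (d * d ^ (2 * k - 3))"
    proof -
      have "1 / 2 * (\<eta> * m) \<le> p * (\<eta> * m)" using True \<eta>m by (intro mult_right_mono) auto
      then have "2 \<le> \<eta> * d" using \<eta>m unfolding d_def by (simp add: mult_ac)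
      then have "2 * (d * d ^ (2 * k - 3)) \<le> (\<eta> * d) * (d * d ^ (2 * k - 3))"
        using d_pos by (intro mult_right_mono) auto
      then show ?thesis by (simp add: mult_ac)
    qed
    finally show ?thesis unfolding q by (simp add: mult_ac)
  next
    case False
    \<comment> \<open>a vertex x and its neighbourhood span far more edges than expected, so that d is at most of order e^2\<close>
    obtain x where x: "x \<in> U" using ne by blast
    define N where "N = {y\<in>U. {x, y} \<in> edges \<Gamma>}"
    have NU: "N \<subseteq> U" and finN: "finite N" using finU by (auto simp: N_def)
    have cN: "(\<Sum>y\<in>U. B x y) = real (card N)"
    proof -
      have "(\<Sum>y\<in>U. B x y) = (\<Sum>y\<in>N. 1)"
        unfolding B_def adj_def N_def using finU by (intro sum.mono_neutral_cong_right) auto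
      then show ?thesis by simp
    qed
    have "s \<le> (\<Sum>y\<in>U. a x y)" by (rule min_deg[OF x])
    moreover have "(\<Sum>y\<in>U. a x y) \<le> (\<Sum>y\<in>U. B x y)" by (rule sum_mono) (simp add: ab)
    moreover have "1 * d \<le> (1 + \<delta> / 2) * d" using \<delta> d_pos by (intro mult_right_mono) auto
    then have "d \<le> 2 * s" using s2 by simp
    ultimately have dN: "d \<le> 2 * real (card N)" unfolding cN by linarith
    have "(\<Sum>y\<in>N. B x y - p) = real (card N) * (1 - p)"
    proof -
      have "(\<Sum>y\<in>N. B x y - p) = (\<Sum>y\<in>N. 1 - p)" by (rule sum.cong) (auto simp: N_def B_def adj_def)
      then show ?thesis by simp
    qed
    then have "real (card N) * (1 - p) \<le> c * sqrt (real (card N))"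
      using cut[of "{x}" N] subsetD[OF U x] subset_trans[OF NU U] by simp
    moreover have "real (card N) * (1 / 2) \<le> real (card N) * (1 - p)" using False by (intro mult_left_mono) auto
    ultimately have "sqrt (real (card N)) * sqrt (real (card N)) \<le> (2 * c) * sqrt (real (card N))" by simp
    moreover have "0 < sqrt (real (card N))" using dN d_pos by simp
    ultimately have "sqrt (real (card N)) \<le> 2 * c" by (rule mult_right_le_imp_le)
    then have "(sqrt (real (card N)))\<^sup>2 \<le> (2 * c)\<^sup>2" by (intro power_mono) auto
    then have "d \<le> 8 * c\<^sup>2" using dN by (simp add: power_mult_distrib)
    also have "\<dots> \<le> 8 * e\<^sup>2" using ce c_pos by (intro mult_left_mono power_mono) auto
    finally have de: "d \<le> 8 * e\<^sup>2" .
    have q: "2 * k - 1 = (2 * k - 3) + 2" "2 * k = Suc (2 * k - 1)" using k2 by auto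
    have "(m * e ^ (2 * k - 3)) * d \<le> (m * e ^ (2 * k - 3)) * (8 * e\<^sup>2)"
      using de m_pos e_pos by (intro mult_left_mono) auto
    also have "\<dots> = 8 * (m * e ^ (2 * k - 1))" unfolding q(1) power_add by simp
    also have "\<dots> \<le> \<eta> * d ^ (2 * k)" using me by simp
    also have "\<dots> = (\<eta> * d ^ (2 * k - 1)) * d" by (subst q(2)) simp
    finally show ?thesis using d_pos by (rule mult_right_le_imp_le)
  qed
  have "\<exists>x xs. xs \<in> walk_lists U (\<lambda>x y. {x, y} \<in> edges H) (2 * k + 1) x x \<and> distinct (take (2 * k + 1) xs)"
  proof (rule exists_odd_cycle[of "\<lambda>x y. {x, y} \<in> edges H" d "4 / \<delta>" "\<delta> / 2" \<eta>])
    show "a = (\<lambda>x y. of_bool ({x, y} \<in> edges H))" by (simp add: a_def adj_def fun_eq_iff)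
    show "{x, x} \<notin> edges H" for x using adj_irrefl[OF Hg, of x] by (auto simp: adj_def)
    show "2 * p * n \<le> 4 / \<delta> * d" using pnd \<delta> by (simp add: field_simps)
    show "1 \<le> 4 / \<delta>" using \<delta> by (simp add: field_simps)
    show "real (card U) * e ^ (2 * k - 1) \<le> \<eta> * d ^ (2 * k)"
    proof -
      have "\<eta> / 8 * d ^ (2 * k) \<le> \<eta> * d ^ (2 * k)" using \<eta> d_pos by (intro mult_right_mono) auto
      with me show ?thesis unfolding m_def by linarith
    qed
    show "1 \<le> \<eta> * real (card U)" using \<eta>m unfolding m_def by linarith
    show "d = p * real (card U)" unfolding d_def m_def ..
    show "0 < \<delta> / 2" using \<delta> by simp
    show "real (card U) * e ^ (2 * k - 3) \<le> \<eta> * d ^ (2 * k - 1)" if "2 \<le> k"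
      using odd[OF that] unfolding m_def .
  qed (fact d_pos, fact s2, fact \<eta>(1), fact \<eta>(3), fact e\<eta>, fact \<eta>d)
  then obtain x xs where "xs \<in> walk_lists U (\<lambda>x y. {x, y} \<in> edges H) (2 * k + 1) x x"
    "distinct (take (2 * k + 1) xs)" by blast
  then show ?thesis by (intro contains_cycle_of_closed_walk[OF Hg]) auto
qed

text \<open>
  The first bound on L is used for large p, where n alone makes the error small. The second one is
  the power of the logarithm in the theorem; it holds also for k = 1, where L = 1.
\<close>

lemma exists_binary_length:
  assumes "1 \<le> k" "3 \<le> n"
  shows "\<exists>L. n ^ (k - 1) < 2 ^ L \<and> real L \<le> 1 + 2 * real (k - 1) * ln (real n)
    \<and> real L \<le> 2 * real k * ln (real n) ^ (2 * (k - 1))"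
proof -
  obtain l where l: "2 ^ l \<le> n ^ (k - 1)" "n ^ (k - 1) < 2 ^ (l + 1)"
    using ex_power_ivl1[of 2 "n ^ (k - 1)"] assms by auto
  have ln2: "1 / 2 \<le> ln (2::real)"
    by (rule ln_ge_iff[THEN iffD2, OF _ exp_half_le2]) simp
  have ln3: "1 \<le> ln (real n)"
  proof -
    have "exp 1 \<le> real n" using exp_le assms by linarith
    then show ?thesis using assms by (simp add: ln_ge_iff)
  qed
  have "real (2 ^ l) \<le> real (n ^ (k - 1))" using l(1) by (simp only: of_nat_le_iff)
  then have "ln (2 ^ l) \<le> ln (real n ^ (k - 1))" using assms by simp
  then have "real l * ln 2 \<le> real (k - 1) * ln (real n)" using assms by (simp add: ln_realpow)
  moreover have "real l * (1 / 2) \<le> real l * ln 2" using ln2 by (intro mult_left_mono) auto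
  ultimately have l2: "real (l + 1) \<le> 1 + 2 * real (k - 1) * ln (real n)" by simp
  have "1 + 2 * real (k - 1) * ln (real n) \<le> 2 * real k * ln (real n) ^ (2 * (k - 1))"
  proof (cases "k = 1")
    case True
    then show ?thesis by simp
  next
    case False
    then have "2 \<le> k" using assms by simp
    have "1 + 2 * real (k - 1) * ln (real n) \<le> 2 * real k * ln (real n) ^ 1"
      using \<open>2 \<le> k\<close> ln3 by (simp add: of_nat_diff algebra_simps)
    also have "\<dots> \<le> 2 * real k * ln (real n) ^ (2 * (k - 1))"
      using \<open>2 \<le> k\<close> ln3 by (intro mult_left_mono power_increasing) auto
    finally show ?thesis .
  qed
  with l2 l(2) show ?thesis by (intro exI[of _ "l + 1"]) linarith
qed

lemma eventually_ln_le_linear: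
  fixes C g :: real
  assumes "0 < g"
  shows "\<forall>\<^sub>F n in sequentially. 1 + C * ln (real n) \<le> g * real n"
proof -
  have "(\<lambda>n. ln (real n) / real n) \<longlonglongrightarrow> 0"
    by (rule filterlim_compose[OF ln_x_over_x_tendsto_0 filterlim_real_sequentially])
  then have "(\<lambda>n. 1 / real n + C * (ln (real n) / real n)) \<longlonglongrightarrow> 0 + C * 0"
    by (intro tendsto_intros lim_1_over_n)
  then have "\<forall>\<^sub>F n in sequentially. 1 / real n + C * (ln (real n) / real n) < g"
    using assms by (intro order_tendstoD) auto
  then show ?thesis
    using eventually_gt_at_top[of 0] by eventually_elim (simp add: field_simps)
qed

text \<open>
  Two cases bound the cut parameter 4 \<beta> + p in terms of the hypothesis on \<beta>. If p \<le> 1/2, an edge of the graph is a pair of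
  singletons with deviation 1 - p \<ge> 1/2 from the density, so that \<beta> \<ge> 1/2 and
  4 \<beta> + p is at most 6 \<beta>. If p > 1/2, the allowed error is almost linear in n and absorbs the summand
  p for large n.
\<close>

theorem theorem3:
  fixes k :: nat and \<delta> :: real
  assumes "k \<ge> 1" and "\<delta> > 0"
  shows "\<exists>\<gamma>>0. \<forall>p :: nat \<Rightarrow> real. (\<forall>n. 0 < p n \<and> p n \<le> 1) \<longrightarrow>
    (\<exists>n\<^sub>0. \<forall>n\<ge>n\<^sub>0. \<forall>(\<Gamma> :: 'a graph) (\<beta> :: real).
       finite_simple_graph \<Gamma> \<longrightarrow> card (verts \<Gamma>) = n \<longrightarrow> jumbled (p n) \<beta> \<Gamma> \<longrightarrow>
       \<beta> \<le> \<gamma> * p n powr (1 + 1 / (2 * real k - 1)) * real n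
             * ln (real n) powi (- 2 * (int k - 1)) \<longrightarrow>
       real (ex \<Gamma> (cycle_graph (2 * k + 1))) < (1 / 2 + \<delta>) * p n * real (n choose 2))"
proof -
  define \<delta>' where "\<delta>' = min \<delta> (1 / 4)"
  have \<delta>': "0 < \<delta>'" "\<delta>' \<le> 1 / 4" "\<delta>' \<le> \<delta>" using assms by (auto simp: \<delta>'_def)
  define M where "M = 4 ^ k * error_const k (4 / \<delta>')"
  have M: "0 < M" unfolding M_def using \<delta>' by (intro mult_pos_pos error_const_pos) (auto simp: field_simps)
  define \<eta> where "\<eta> = min (\<delta>' / 8) (\<delta>' / (4 * M))"
  have \<eta>: "0 < \<eta>" "\<eta> \<le> \<delta>' / 8" using \<delta>' M by (auto simp: \<eta>_def)
  have "M * \<eta> \<le> M * (\<delta>' / (4 * M))" unfolding \<eta>_def using M by (intro mult_left_mono) auto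
  also have "\<dots> < \<delta>' / 2" using M \<delta>' by (simp add: field_simps)
  finally have \<eta>M: "4 ^ k * error_const k (4 / \<delta>') * \<eta> < \<delta>' / 2" unfolding M_def .
  define g where "g = \<eta> / 8 * (\<delta>' / 2) ^ (2 * k)"
  have g: "0 < g" unfolding g_def using \<eta> \<delta>' by simp
  define \<gamma> where "\<gamma> = g / (24 * real k)"
  have \<gamma>: "0 < \<gamma>" "24 * real k * \<gamma> = g" unfolding \<gamma>_def using g assms by auto
  obtain n1 where n1: "\<And>n. n \<ge> n1 \<Longrightarrow> 1 + 2 * real (k - 1) * ln (real n) \<le> g / 8 * real n"
    using eventually_ln_le_linear[of "g / 8" "2 * real (k - 1)"] g unfolding eventually_sequentially by auto
  obtain n2 :: nat where n2: "16 / (\<eta> * \<delta>') \<le> real n2" using real_arch_simple by blast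
  show ?thesis
  proof (intro exI[of _ \<gamma>] conjI \<gamma>(1) allI impI exI[of _ "max 3 (max n1 n2)"])
    fix p :: "nat \<Rightarrow> real" and n :: nat and \<Gamma> :: "'a graph" and \<beta> :: real
    assume p': "\<forall>n. 0 < p n \<and> p n \<le> 1" and n: "max 3 (max n1 n2) \<le> n"
      and G: "finite_simple_graph \<Gamma>" and card: "card (verts \<Gamma>) = n" and J: "jumbled (p n) \<beta> \<Gamma>"
      and \<beta>_le: "\<beta> \<le> \<gamma> * p n powr (1 + 1 / (2 * real k - 1)) * real n * ln (real n) powi (- 2 * (int k - 1))"
    define q where "q = p n"
    have q: "0 < q" "q \<le> 1" using p' by (auto simp: q_def)
    define P where "P = q powr (1 + 1 / (2 * real k - 1))"
    have P: "0 < P" unfolding P_def using q by simp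
    let ?F = "cycle_graph (2 * k + 1)"
    show "real (ex \<Gamma> ?F) < (1 / 2 + \<delta>) * p n * real (n choose 2)"
    proof (rule ccontr)
      assume "\<not> ?thesis"
      then have big: "(1 / 2 + \<delta>) * q * real (n choose 2) \<le> real (ex \<Gamma> ?F)" unfolding q_def by simp
      have "edges ?F \<noteq> {}" by (auto simp: cycle_graph_def)
      from ex_attained(1)[OF G this] obtain H where
        H: "subgraph H \<Gamma>" "\<not> contains_copy H ?F" "card (edges H) = ex \<Gamma> ?F" by blast
      have c2: "2 * real (n choose 2) = real n * (real n - 1)"
      proof -
        have "even (n * (n - 1))" by (cases n) auto
        then have "2 * (n choose 2) = n * (n - 1)" unfolding choose_two by (rule dvd_mult_div_cancel)
        then have "2 * real (n choose 2) = real (n * (n - 1))" by (metis of_nat_mult of_nat_numeral)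
        then show ?thesis using n by (simp add: of_nat_diff)
      qed
      have "0 < real n * (real n - 1)" using n by simp
      then have c2_pos: "0 < real (n choose 2)" using c2 by linarith
      have "(1 / 2 + \<delta>') * q * (real n * (real n - 1)) \<le> (1 / 2 + \<delta>) * q * (real n * (real n - 1))"
        using \<delta>' q \<open>0 < real n * (real n - 1)\<close> by (intro mult_right_mono) auto
      also have "\<dots> = 2 * ((1 / 2 + \<delta>) * q * real (n choose 2))" using c2 by simp
      also have "\<dots> \<le> 2 * real (card (edges H))" using big H(3) by simp
      finally have dense: "(1 / 2 + \<delta>') * q * (real n * (real n - 1)) \<le> 2 * real (card (edges H))" .
      have "0 < (1 / 2 + \<delta>) * q * real (n choose 2)" using assms q c2_pos by simp
      with big H(3) have "edges H \<noteq> {}" by auto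
      then obtain f where f: "f \<in> edges \<Gamma>" using H(1) by (auto simp: subgraph_def)
      then have "f \<in> nsets (verts \<Gamma>) 2" using G by (auto simp: finite_simple_graph_def)
      then obtain x y where xy: "f = {x, y}" "x \<noteq> y" "x \<in> verts \<Gamma>" "y \<in> verts \<Gamma>" by (auto simp: nsets_2_eq)
      have pb: "pairs_between {x} {y} = {{x, y}}" using xy(2) by (auto simp: pairs_between_def)
      have "edges \<Gamma> \<inter> {{x, y}} = {{x, y}}" using f unfolding xy(1) by blast
      then have "edges_between \<Gamma> {x} {y} = 1" "vol {x} {y} = 1"
        unfolding edges_between_def vol_def pb by simp_all
      moreover have "\<bar>real (edges_between \<Gamma> {x} {y}) - q * real (vol {x} {y})\<bar>
          \<le> \<beta> * sqrt (real (vol {x} {y}))"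
        using J xy(3,4) unfolding jumbled_def q_def by blast
      ultimately have q\<beta>: "1 - q \<le> \<beta>" by simp
      then have \<beta>0: "0 \<le> \<beta>" using q by linarith
      obtain L where L: "n ^ (k - 1) < 2 ^ L" "real L \<le> 1 + 2 * real (k - 1) * ln (real n)"
        "real L \<le> 2 * real k * ln (real n) ^ (2 * (k - 1))"
        using exists_binary_length[OF assms(1), of n] n by auto
      have ln_pos: "0 < ln (real n)" using n by simp
      have "- 2 * (int k - 1) = - int (2 * (k - 1))" using assms by (simp add: of_nat_diff)
      then have powi: "ln (real n) powi (- 2 * (int k - 1)) = inverse (ln (real n) ^ (2 * (k - 1)))"
        by (simp only: power_int_minus power_int_of_nat)
      have L\<beta>: "real L * \<beta> \<le> g / 12 * (P * real n)"
      proof -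
        have "real L * \<beta> \<le> (2 * real k * ln (real n) ^ (2 * (k - 1)))
            * (\<gamma> * P * real n * inverse (ln (real n) ^ (2 * (k - 1))))"
          using L(3) \<beta>_le \<beta>0 unfolding powi P_def q_def by (intro mult_mono) auto
        also have "\<dots> = 2 * real k * \<gamma> * (P * real n)" using ln_pos by simp
        also have "\<dots> = g / 12 * (P * real n)" using \<gamma>(2) by simp
        finally show ?thesis .
      qed
      have Pn: "0 \<le> P * (g * real n)" "0 \<le> g * (P * real n)" using P g by auto
      have "real L * (4 * \<beta> + q) \<le> g * (P * real n)"
      proof (cases "1 / 2 < q")
        case True
        have "1 / 4 \<le> P"
        proof -
          have "(1 / 2) powr 2 \<le> q powr 2" using True by (intro powr_mono2) auto
          also have "\<dots> \<le> P" unfolding P_def using q assms by (intro powr_mono') (auto simp: field_simps)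
          finally show ?thesis by (simp add: power2_eq_square)
        qed
        have "real L * q \<le> real L * 1" using q by (intro mult_left_mono) auto
        also have "\<dots> \<le> g / 8 * real n" using L(2) n1[of n] n by simp
        also have "\<dots> = g / 2 * (1 / 4 * real n)" by simp
        also have "\<dots> \<le> g / 2 * (P * real n)"
          using \<open>1 / 4 \<le> P\<close> g by (intro mult_left_mono mult_right_mono) auto
        finally have Lq: "real L * q \<le> g / 2 * (P * real n)" .
        have "real L * (4 * \<beta> + q) = 4 * (real L * \<beta>) + real L * q"
          by (simp add: algebra_simps)
        also have "\<dots> \<le> 4 * (g / 12 * (P * real n)) + g / 2 * (P * real n)"
          by (intro add_mono mult_left_mono L\<beta> Lq) auto
        also have "\<dots> \<le> g * (P * real n)" using Pn g by simp
        finally show ?thesis .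
      next
        case False
        then have "4 * \<beta> + q \<le> 6 * \<beta>" using q\<beta> by linarith
        then have "real L * (4 * \<beta> + q) \<le> real L * (6 * \<beta>)" by (intro mult_left_mono) auto
        also have "\<dots> \<le> 6 * (g / 12 * (P * real n))" using L\<beta> by (simp add: mult_ac)
        also have "\<dots> \<le> g * (P * real n)" using Pn g by simp
        finally show ?thesis .
      qed
      moreover have "16 \<le> \<eta> * \<delta>' * real n"
      proof -
        have "16 / (\<eta> * \<delta>') \<le> real n" using n2 n by linarith
        then show ?thesis using \<eta> \<delta>' by (simp add: divide_le_eq mult_ac)
      qed
      moreover have "1 / 2 < q \<or> 1 / 2 \<le> \<beta>" using q\<beta> by linarith
      ultimately have "contains_copy H ?F"
        using L(1) dense unfolding g_def P_def card[symmetric]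
        by (intro contains_odd_cycle_of_dense[OF G H(1) J[folded q_def] assms(1) \<delta>'(1,2) q \<beta>0 \<eta> \<eta>M])
      with H(2) show False by contradiction
    qed
  qed
qed

end
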